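(* Let $(\mathcal{M},\otimes,\mathbf{1})$ be a cocomplete coabelian monoidal category satisfying AB5. Let $D$ and $E$ be coalgebras in $\mathcal{M}$ and let $\delta:D\to E$ be a monomorphism in $\mathcal{M}$ which is a morphism of coalgebras. Let $(\widetilde{D}_E,(\xi_i)_{i\in\mathbb{N}})=\varinjlim_{i} D^{\wedge_E^i}$ be the direct limit of the iterated wedge powers of $D$ in $E$, and let $\widetilde{\delta}:\widetilde{D}_E\to E$ be the canonical coalgebra homomorphism. Let $C$ be a coalgebra in $\mathcal{M}$ and let $f:E\to C$ be a coalgebra homomorphism such that $$f\circ\delta_2: D\wedge_E D\to C$$ is a monomorphism, where $\delta_2:D\wedge_E D=D^{\wedge_E^2}\to E$ is the canonical monomorphism. Then the coalgebra homomorphism $$f\circ\widetilde{\delta}:\widetilde{D}_E\to C$$ is a monomorphism.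
   Context: A coabelian monoidal category is a monoidal category $(\mathcal{M},\otimes,\mathbf{1})$ such that $\mathcal{M}$ is an abelian category and, for every object $X$, both functors $X\otimes(-)$ and $(-)\otimes X$ from $\mathcal{M}$ to $\mathcal{M}$ are additive and left exact. AB5 means that direct limits (filtered colimits) are exact. Associativity and unit constraints are suppressed. A coalgebra in $\mathcal{M}$ is an object with a coassociative comultiplication $\Delta$ and a counit $\varepsilon$, as usual; coalgebra morphisms preserve both. For a coalgebra $E$, set $\Delta_E^0=\mathrm{Id}_E$, $\Delta_E^1=\Delta_E$ and $\Delta_E^n=(\Delta_E^{n-1}\otimes E)\circ\Delta_E:E\to E^{\otimes n+1}$ for $n>1$ (where $E$ also denotes $\mathrm{Id}_E$). Let $\delta:D\to E$ be a monomorphism which is a coalgebra homomorphism, and let $p:E\to E/D$ be its cokernel in $\mathcal{M}$. For $n\ge 1$ define $$(D^{\wedge_E^n},\delta_n):=\ker\big(p^{\otimes n}\circ\Delta_E^{n-1}:E\to (E/D)^{\otimes n}\big),$$ with $\delta_n:D^{\wedge_E^n}\to E$ the kernel monomorphism, and $(D^{\wedge_E^0},\delta_0)=(0,0)$. Thus $(D^{\wedge_E^1},\delta_1)=(D,\delta)$ and $D^{\wedge_E^2}=D\wedge_E D=\ker((p\otimes p)\circ\Delta_E)$. The following facts are known and are used to make sense of the statement. Each $D^{\wedge_E^n}$ has a (unique) coalgebra structure making $\delta_n$ a coalgebra homomorphism. For $i\le j$ there is a unique morphism $\xi_i^j:D^{\wedge_E^i}\to D^{\wedge_E^j}$ with $\delta_j\circ\xi_i^j=\delta_i$;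 it is a coalgebra homomorphism, and $((D^{\wedge_E^i})_{i\in\mathbb{N}},(\xi_i^j)_{i\le j})$ is a direct system in $\mathcal{M}$. Its direct limit in $\mathcal{M}$, denoted $(\widetilde{D}_E,(\xi_i)_{i\in\mathbb{N}})$ with structural morphisms $\xi_i:D^{\wedge_E^i}\to\widetilde{D}_E$, carries a natural coalgebra structure making it the direct limit of this system in the category of coalgebras. The morphism $\widetilde{\delta}:\widetilde{D}_E\to E$ is the unique (coalgebra) morphism such that $\widetilde{\delta}\circ\xi_i=\delta_i$ for every $i\in\mathbb{N}$. *)

theory Defs
  imports "HOL-Algebra.Group"
begin

section \<open>Categories\<close>

record ('o, 'm) cat =
  Ob :: "'o set"
  Ar :: "'m set"
  Dom :: "'m \<Rightarrow> 'o"
  Cod :: "'m \<Rightarrow> 'o"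
  Idn :: "'o \<Rightarrow> 'm" ("\<iota>\<index>")
  Cmp :: "'m \<Rightarrow> 'm \<Rightarrow> 'm" (infixr "\<cdot>\<index>" 65)

definition Hom :: "('o, 'm, 'x) cat_scheme \<Rightarrow> 'o \<Rightarrow> 'o \<Rightarrow> 'm set" where
  "Hom M A B = {f \<in> Ar M. Dom M f = A \<and> Cod M f = B}"

locale category =
  fixes M :: "('o, 'm, 'x) cat_scheme" (structure)
  assumes Dom_in_Ob: "f \<in> Ar M \<Longrightarrow> Dom M f \<in> Ob M"
    and Cod_in_Ob: "f \<in> Ar M \<Longrightarrow> Cod M f \<in> Ob M"
    and Idn_in_Hom: "A \<in> Ob M \<Longrightarrow> \<iota> A \<in> Hom M A A"
    and Cmp_in_Hom: "\<lbrakk>f \<in> Hom M A B; g \<in> Hom M B C\<rbrakk> \<Longrightarrow> g \<cdot> f \<in> Hom M A C"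
    and Cmp_Idn: "f \<in> Hom M A B \<Longrightarrow> f \<cdot> \<iota> A = f"
    and Idn_Cmp: "f \<in> Hom M A B \<Longrightarrow> \<iota> B \<cdot> f = f"
    and Cmp_assoc: "\<lbrakk>f \<in> Hom M A B; g \<in> Hom M B C; h \<in> Hom M C D\<rbrakk>
      \<Longrightarrow> (h \<cdot> g) \<cdot> f = h \<cdot> (g \<cdot> f)"

definition monic :: "('o, 'm, 'x) cat_scheme \<Rightarrow> 'm \<Rightarrow> bool" where
  "monic M f \<longleftrightarrow> f \<in> Ar M \<and>
    (\<forall>X. \<forall>g \<in> Hom M X (Dom M f). \<forall>h \<in> Hom M X (Dom M f).
      Cmp M f g = Cmp M f h \<longrightarrow> g = h)"

definition epic :: "('o, 'm, 'x) cat_scheme \<Rightarrow> 'm \<Rightarrow> bool" where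
  "epic M f \<longleftrightarrow> f \<in> Ar M \<and>
    (\<forall>X. \<forall>g \<in> Hom M (Cod M f) X. \<forall>h \<in> Hom M (Cod M f) X.
      Cmp M g f = Cmp M h f \<longrightarrow> g = h)"

definition is_iso :: "('o, 'm, 'x) cat_scheme \<Rightarrow> 'm \<Rightarrow> bool" where
  "is_iso M f \<longleftrightarrow> f \<in> Ar M \<and>
    (\<exists>g \<in> Hom M (Cod M f) (Dom M f).
      Cmp M g f = Idn M (Dom M f) \<and> Cmp M f g = Idn M (Cod M f))"

definition is_zero_object :: "('o, 'm, 'x) cat_scheme \<Rightarrow> 'o \<Rightarrow> bool" where
  "is_zero_object M Z \<longleftrightarrow> Z \<in> Ob M \<and>
    (\<forall>A \<in> Ob M. (\<exists>!f. f \<in> Hom M A Z) \<and> (\<exists>!f. f \<in> Hom M Z A))"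

definition is_functor ::
  "('i, 'a, 'x) cat_scheme \<Rightarrow> ('o, 'm, 'y) cat_scheme \<Rightarrow> ('i \<Rightarrow> 'o) \<Rightarrow> ('a \<Rightarrow> 'm) \<Rightarrow> bool" where
  "is_functor I M Fo Fa \<longleftrightarrow>
    (\<forall>i \<in> Ob I. Fo i \<in> Ob M) \<and>
    (\<forall>i j. \<forall>u \<in> Hom I i j. Fa u \<in> Hom M (Fo i) (Fo j)) \<and>
    (\<forall>i \<in> Ob I. Fa (Idn I i) = Idn M (Fo i)) \<and>
    (\<forall>i j k. \<forall>u \<in> Hom I i j. \<forall>v \<in> Hom I j k.
      Fa (Cmp I v u) = Cmp M (Fa v) (Fa u))"

definition is_nat_trans ::
  "('i, 'a, 'x) cat_scheme \<Rightarrow> ('o, 'm, 'y) cat_scheme \<Rightarrow> ('i \<Rightarrow> 'o) \<Rightarrow> ('a \<Rightarrow> 'm)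
    \<Rightarrow> ('i \<Rightarrow> 'o) \<Rightarrow> ('a \<Rightarrow> 'm) \<Rightarrow> ('i \<Rightarrow> 'm) \<Rightarrow> bool" where
  "is_nat_trans I M Fo Fa Go Ga \<alpha> \<longleftrightarrow>
    (\<forall>i \<in> Ob I. \<alpha> i \<in> Hom M (Fo i) (Go i)) \<and>
    (\<forall>i j. \<forall>u \<in> Hom I i j. Cmp M (Ga u) (\<alpha> i) = Cmp M (\<alpha> j) (Fa u))"


section \<open>Colimits\<close>

definition is_cocone ::
  "('i, 'a, 'x) cat_scheme \<Rightarrow> ('o, 'm, 'y) cat_scheme \<Rightarrow> ('i \<Rightarrow> 'o) \<Rightarrow> ('a \<Rightarrow> 'm)
    \<Rightarrow> 'o \<Rightarrow> ('i \<Rightarrow> 'm) \<Rightarrow> bool" where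
  "is_cocone I M Fo Fa L c \<longleftrightarrow> L \<in> Ob M \<and>
    (\<forall>i \<in> Ob I. c i \<in> Hom M (Fo i) L) \<and>
    (\<forall>i j. \<forall>u \<in> Hom I i j. Cmp M (c j) (Fa u) = c i)"

definition is_colimit ::
  "('i, 'a, 'x) cat_scheme \<Rightarrow> ('o, 'm, 'y) cat_scheme \<Rightarrow> ('i \<Rightarrow> 'o) \<Rightarrow> ('a \<Rightarrow> 'm)
    \<Rightarrow> 'o \<Rightarrow> ('i \<Rightarrow> 'm) \<Rightarrow> bool" where
  "is_colimit I M Fo Fa L c \<longleftrightarrow> is_cocone I M Fo Fa L c \<and>
    (\<forall>X d. is_cocone I M Fo Fa X d \<longrightarrow>
      (\<exists>!h. h \<in> Hom M L X \<and> (\<forall>i \<in> Ob I. Cmp M h (c i) = d i)))"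

text \<open>
  The type \<open>'i\<close> plays the role of the universe: a category is small if its objects and its
  arrows form subsets of \<open>'i\<close>. For infinite \<open>'i\<close> these are, up to isomorphism, exactly the
  categories with at most as many arrows as \<open>'i\<close> has elements. Index categories
  must not be allowed to range over the type of arrows of \<open>M\<close> itself: a category having
  coproducts of that size is a preorder.
\<close>

definition cocomplete :: "'i itself \<Rightarrow> ('o, 'm, 'x) cat_scheme \<Rightarrow> bool" where
  "cocomplete T M \<longleftrightarrow>
    (\<forall>(I :: ('i, 'i) cat) Fo Fa. category I \<longrightarrow> is_functor I M Fo Fa \<longrightarrow>
      (\<exists>L c. is_colimit I M Fo Fa L c))"

definition filtered :: "('i, 'a, 'x) cat_scheme \<Rightarrow> bool" where
  "filtered I \<longleftrightarrow> category I \<and> Ob I \<noteq> {} \<and>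
    (\<forall>i \<in> Ob I. \<forall>j \<in> Ob I. \<exists>k u v. u \<in> Hom I i k \<and> v \<in> Hom I j k) \<and>
    (\<forall>i j. \<forall>u \<in> Hom I i j. \<forall>v \<in> Hom I i j.
      \<exists>k w. w \<in> Hom I j k \<and> Cmp I w u = Cmp I w v)"

definition nat_order_cat :: "(nat, nat \<times> nat) cat" where
  "nat_order_cat = \<lparr>Ob = UNIV, Ar = {(i, j). i \<le> j}, Dom = fst, Cod = snd,
    Idn = (\<lambda>i. (i, i)), Cmp = (\<lambda>v u. (fst u, snd v))\<rparr>"


section \<open>Abelian categories\<close>

record ('o, 'm) preadd_cat = "('o, 'm) cat" +
  Add :: "'m \<Rightarrow> 'm \<Rightarrow> 'm" (infixl "\<boxplus>\<index>" 60)
  Zer :: "'o \<Rightarrow> 'o \<Rightarrow> 'm"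

definition Hom_group :: "('o, 'm, 'x) preadd_cat_scheme \<Rightarrow> 'o \<Rightarrow> 'o \<Rightarrow> 'm monoid" where
  "Hom_group M A B = \<lparr>carrier = Hom M A B, monoid.mult = Add M, one = Zer M A B\<rparr>"

locale preadditive_category = category M for M :: "('o, 'm, 'x) preadd_cat_scheme" (structure) +
  assumes Hom_comm_group: "\<lbrakk>A \<in> Ob M; B \<in> Ob M\<rbrakk> \<Longrightarrow> comm_group (Hom_group M A B)"
    and Cmp_Add_right: "\<lbrakk>f \<in> Hom M A B; g \<in> Hom M A B; h \<in> Hom M B C\<rbrakk>
      \<Longrightarrow> h \<cdot> (f \<boxplus> g) = (h \<cdot> f) \<boxplus> (h \<cdot> g)"
    and Cmp_Add_left: "\<lbrakk>f \<in> Hom M B C; g \<in> Hom M B C; h \<in> Hom M A B\<rbrakk>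
      \<Longrightarrow> (f \<boxplus> g) \<cdot> h = (f \<cdot> h) \<boxplus> (g \<cdot> h)"

definition is_kernel :: "('o, 'm, 'x) preadd_cat_scheme \<Rightarrow> 'm \<Rightarrow> 'm \<Rightarrow> bool" where
  "is_kernel M f k \<longleftrightarrow> f \<in> Ar M \<and> k \<in> Ar M \<and> Cod M k = Dom M f \<and>
    Cmp M f k = Zer M (Dom M k) (Cod M f) \<and>
    (\<forall>X. \<forall>h \<in> Hom M X (Dom M f). Cmp M f h = Zer M X (Cod M f) \<longrightarrow>
      (\<exists>!u. u \<in> Hom M X (Dom M k) \<and> Cmp M k u = h))"

definition is_cokernel :: "('o, 'm, 'x) preadd_cat_scheme \<Rightarrow> 'm \<Rightarrow> 'm \<Rightarrow> bool" where
  "is_cokernel M f c \<longleftrightarrow> f \<in> Ar M \<and> c \<in> Ar M \<and> Dom M c = Cod M f \<and>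
    Cmp M c f = Zer M (Dom M f) (Cod M c) \<and>
    (\<forall>X. \<forall>h \<in> Hom M (Cod M f) X. Cmp M h f = Zer M (Dom M f) X \<longrightarrow>
      (\<exists>!u. u \<in> Hom M (Cod M c) X \<and> Cmp M u c = h))"

definition is_biproduct ::
  "('o, 'm, 'x) preadd_cat_scheme \<Rightarrow> 'o \<Rightarrow> 'o \<Rightarrow> 'o \<Rightarrow> 'm \<Rightarrow> 'm \<Rightarrow> 'm \<Rightarrow> 'm \<Rightarrow> bool" where
  "is_biproduct M A B P i\<^sub>1 i\<^sub>2 p\<^sub>1 p\<^sub>2 \<longleftrightarrow> P \<in> Ob M \<and>
    i\<^sub>1 \<in> Hom M A P \<and> i\<^sub>2 \<in> Hom M B P \<and> p\<^sub>1 \<in> Hom M P A \<and> p\<^sub>2 \<in> Hom M P B \<and>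
    Cmp M p\<^sub>1 i\<^sub>1 = Idn M A \<and> Cmp M p\<^sub>2 i\<^sub>2 = Idn M B \<and>
    Add M (Cmp M i\<^sub>1 p\<^sub>1) (Cmp M i\<^sub>2 p\<^sub>2) = Idn M P"

locale abelian_category = preadditive_category M for M :: "('o, 'm, 'x) preadd_cat_scheme" (structure) +
  assumes ex_zero_object: "\<exists>Z. is_zero_object M Z"
    and ex_biproduct: "\<lbrakk>A \<in> Ob M; B \<in> Ob M\<rbrakk>
      \<Longrightarrow> \<exists>P i\<^sub>1 i\<^sub>2 p\<^sub>1 p\<^sub>2. is_biproduct M A B P i\<^sub>1 i\<^sub>2 p\<^sub>1 p\<^sub>2"
    and ex_kernel: "f \<in> Ar M \<Longrightarrow> \<exists>k. is_kernel M f k"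
    and ex_cokernel: "f \<in> Ar M \<Longrightarrow> \<exists>c. is_cokernel M f c"
    and monic_normal: "monic M f \<Longrightarrow> \<exists>g. is_kernel M g f"
    and epic_normal: "epic M f \<Longrightarrow> \<exists>g. is_cokernel M g f"

text \<open>Exactness of \<open>A \<rightarrow> B \<rightarrow> C\<close> at \<open>B\<close>: the image of \<open>f\<close>, i.e. the kernel of its cokernel,
  is the kernel of \<open>g\<close>.\<close>

definition exact_at :: "('o, 'm, 'x) preadd_cat_scheme \<Rightarrow> 'm \<Rightarrow> 'm \<Rightarrow> bool" where
  "exact_at M f g \<longleftrightarrow> (\<exists>c k. is_cokernel M f c \<and> is_kernel M c k \<and> is_kernel M g k)"

definition short_exact :: "('o, 'm, 'x) preadd_cat_scheme \<Rightarrow> 'm \<Rightarrow> 'm \<Rightarrow> bool" where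
  "short_exact M f g \<longleftrightarrow> monic M f \<and> exact_at M f g \<and> epic M g"

definition additive_functor ::
  "('o, 'm, 'x) preadd_cat_scheme \<Rightarrow> ('p, 'n, 'y) preadd_cat_scheme \<Rightarrow>
    ('o \<Rightarrow> 'p) \<Rightarrow> ('m \<Rightarrow> 'n) \<Rightarrow> bool" where
  "additive_functor M N Fo Fa \<longleftrightarrow> is_functor M N Fo Fa \<and>
    (\<forall>A B. \<forall>f \<in> Hom M A B. \<forall>g \<in> Hom M A B. Fa (Add M f g) = Add N (Fa f) (Fa g))"

definition left_exact_functor ::
  "('o, 'm, 'x) preadd_cat_scheme \<Rightarrow> ('p, 'n, 'y) preadd_cat_scheme \<Rightarrow>
    ('o \<Rightarrow> 'p) \<Rightarrow> ('m \<Rightarrow> 'n) \<Rightarrow> bool" where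
  "left_exact_functor M N Fo Fa \<longleftrightarrow> is_functor M N Fo Fa \<and>
    (\<forall>f g. monic M f \<and> exact_at M f g \<longrightarrow> monic N (Fa f) \<and> exact_at N (Fa f) (Fa g))"

text \<open>
  AB5: the functor \<open>colim\<close> on diagrams over a small filtered category is exact. Exactness of a
  sequence of diagrams is objectwise. The universe type \<open>'i\<close> is as in \<open>cocomplete\<close>.
\<close>

definition AB5 :: "'i itself \<Rightarrow> ('o, 'm, 'x) preadd_cat_scheme \<Rightarrow> bool" where
  "AB5 T M \<longleftrightarrow>
    (\<forall>(I :: ('i, 'i) cat) Fo Fa Go Ga Ho Ha \<alpha> \<beta> K a L b N c u v.
      filtered I \<and>
      is_functor I M Fo Fa \<and> is_functor I M Go Ga \<and> is_functor I M Ho Ha \<and>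
      is_nat_trans I M Fo Fa Go Ga \<alpha> \<and> is_nat_trans I M Go Ga Ho Ha \<beta> \<and>
      (\<forall>i \<in> Ob I. short_exact M (\<alpha> i) (\<beta> i)) \<and>
      is_colimit I M Fo Fa K a \<and> is_colimit I M Go Ga L b \<and> is_colimit I M Ho Ha N c \<and>
      u \<in> Hom M K L \<and> (\<forall>i \<in> Ob I. Cmp M u (a i) = Cmp M (b i) (\<alpha> i)) \<and>
      v \<in> Hom M L N \<and> (\<forall>i \<in> Ob I. Cmp M v (b i) = Cmp M (c i) (\<beta> i))
      \<longrightarrow> short_exact M u v)"


section \<open>Coabelian monoidal categories\<close>

record ('o, 'm) monoidal_cat = "('o, 'm) preadd_cat" +
  tob :: "'o \<Rightarrow> 'o \<Rightarrow> 'o" (infixl "\<otimes>\<^sub>o\<index>" 75)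
  tar :: "'m \<Rightarrow> 'm \<Rightarrow> 'm" (infixl "\<otimes>\<^sub>a\<index>" 75)
  unt :: 'o ("\<bbbI>\<index>")
  assoc :: "'o \<Rightarrow> 'o \<Rightarrow> 'o \<Rightarrow> 'm"
  lunit :: "'o \<Rightarrow> 'm"
  runit :: "'o \<Rightarrow> 'm"

locale monoidal_category = category M for M :: "('o, 'm, 'x) monoidal_cat_scheme" (structure) +
  assumes tob_in_Ob: "\<lbrakk>A \<in> Ob M; B \<in> Ob M\<rbrakk> \<Longrightarrow> A \<otimes>\<^sub>o B \<in> Ob M"
    and tar_in_Hom: "\<lbrakk>f \<in> Hom M A A'; g \<in> Hom M B B'\<rbrakk>
      \<Longrightarrow> f \<otimes>\<^sub>a g \<in> Hom M (A \<otimes>\<^sub>o B) (A' \<otimes>\<^sub>o B')"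
    and tar_Idn: "\<lbrakk>A \<in> Ob M; B \<in> Ob M\<rbrakk> \<Longrightarrow> \<iota> A \<otimes>\<^sub>a \<iota> B = \<iota> (A \<otimes>\<^sub>o B)"
    and tar_Cmp: "\<lbrakk>f \<in> Hom M A A'; f' \<in> Hom M A' A''; g \<in> Hom M B B'; g' \<in> Hom M B' B''\<rbrakk>
      \<Longrightarrow> (f' \<cdot> f) \<otimes>\<^sub>a (g' \<cdot> g) = (f' \<otimes>\<^sub>a g') \<cdot> (f \<otimes>\<^sub>a g)"
    and unt_in_Ob: "\<bbbI> \<in> Ob M"
    and assoc_in_Hom: "\<lbrakk>A \<in> Ob M; B \<in> Ob M; C \<in> Ob M\<rbrakk>
      \<Longrightarrow> assoc M A B C \<in> Hom M (A \<otimes>\<^sub>o B \<otimes>\<^sub>o C) (A \<otimes>\<^sub>o (B \<otimes>\<^sub>o C))"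
    and assoc_iso: "\<lbrakk>A \<in> Ob M; B \<in> Ob M; C \<in> Ob M\<rbrakk> \<Longrightarrow> is_iso M (assoc M A B C)"
    and assoc_natural: "\<lbrakk>f \<in> Hom M A A'; g \<in> Hom M B B'; h \<in> Hom M C C'\<rbrakk>
      \<Longrightarrow> assoc M A' B' C' \<cdot> (f \<otimes>\<^sub>a g \<otimes>\<^sub>a h) = (f \<otimes>\<^sub>a (g \<otimes>\<^sub>a h)) \<cdot> assoc M A B C"
    and lunit_in_Hom: "A \<in> Ob M \<Longrightarrow> lunit M A \<in> Hom M (\<bbbI> \<otimes>\<^sub>o A) A"
    and lunit_iso: "A \<in> Ob M \<Longrightarrow> is_iso M (lunit M A)"
    and lunit_natural: "f \<in> Hom M A B \<Longrightarrow> lunit M B \<cdot> (\<iota> \<bbbI> \<otimes>\<^sub>a f) = f \<cdot> lunit M A"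
    and runit_in_Hom: "A \<in> Ob M \<Longrightarrow> runit M A \<in> Hom M (A \<otimes>\<^sub>o \<bbbI>) A"
    and runit_iso: "A \<in> Ob M \<Longrightarrow> is_iso M (runit M A)"
    and runit_natural: "f \<in> Hom M A B \<Longrightarrow> runit M B \<cdot> (f \<otimes>\<^sub>a \<iota> \<bbbI>) = f \<cdot> runit M A"
    and pentagon: "\<lbrakk>A \<in> Ob M; B \<in> Ob M; C \<in> Ob M; D \<in> Ob M\<rbrakk> \<Longrightarrow>
      (\<iota> A \<otimes>\<^sub>a assoc M B C D) \<cdot> assoc M A (B \<otimes>\<^sub>o C) D \<cdot> (assoc M A B C \<otimes>\<^sub>a \<iota> D)
        = assoc M A B (C \<otimes>\<^sub>o D) \<cdot> assoc M (A \<otimes>\<^sub>o B) C D"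
    and triangle: "\<lbrakk>A \<in> Ob M; B \<in> Ob M\<rbrakk> \<Longrightarrow>
      (\<iota> A \<otimes>\<^sub>a lunit M B) \<cdot> assoc M A \<bbbI> B = runit M A \<otimes>\<^sub>a \<iota> B"

locale coabelian_monoidal_category = monoidal_category M + abelian_category M
  for M :: "('o, 'm, 'x) monoidal_cat_scheme" (structure) +
  assumes additive_left: "X \<in> Ob M \<Longrightarrow> additive_functor M M (\<lambda>A. X \<otimes>\<^sub>o A) (\<lambda>f. \<iota> X \<otimes>\<^sub>a f)"
    and left_exact_left: "X \<in> Ob M \<Longrightarrow> left_exact_functor M M (\<lambda>A. X \<otimes>\<^sub>o A) (\<lambda>f. \<iota> X \<otimes>\<^sub>a f)"
    and additive_right: "X \<in> Ob M \<Longrightarrow> additive_functor M M (\<lambda>A. A \<otimes>\<^sub>o X) (\<lambda>f. f \<otimes>\<^sub>a \<iota> X)"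
    and left_exact_right: "X \<in> Ob M \<Longrightarrow> left_exact_functor M M (\<lambda>A. A \<otimes>\<^sub>o X) (\<lambda>f. f \<otimes>\<^sub>a \<iota> X)"


section \<open>Coalgebras and wedge powers\<close>

record ('o, 'm) coalg =
  cob :: 'o
  comult :: 'm
  counit :: 'm

definition is_coalgebra :: "('o, 'm, 'x) monoidal_cat_scheme \<Rightarrow> ('o, 'm) coalg \<Rightarrow> bool" where
  "is_coalgebra M E \<longleftrightarrow> cob E \<in> Ob M \<and>
    comult E \<in> Hom M (cob E) (cob E \<otimes>\<^sub>o\<^bsub>M\<^esub> cob E) \<and>
    counit E \<in> Hom M (cob E) \<bbbI>\<^bsub>M\<^esub> \<and>
    assoc M (cob E) (cob E) (cob E) \<cdot>\<^bsub>M\<^esub> (comult E \<otimes>\<^sub>a\<^bsub>M\<^esub> \<iota>\<^bsub>M\<^esub> (cob E)) \<cdot>\<^bsub>M\<^esub> comult E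
      = (\<iota>\<^bsub>M\<^esub> (cob E) \<otimes>\<^sub>a\<^bsub>M\<^esub> comult E) \<cdot>\<^bsub>M\<^esub> comult E \<and>
    lunit M (cob E) \<cdot>\<^bsub>M\<^esub> (counit E \<otimes>\<^sub>a\<^bsub>M\<^esub> \<iota>\<^bsub>M\<^esub> (cob E)) \<cdot>\<^bsub>M\<^esub> comult E = \<iota>\<^bsub>M\<^esub> (cob E) \<and>
    runit M (cob E) \<cdot>\<^bsub>M\<^esub> (\<iota>\<^bsub>M\<^esub> (cob E) \<otimes>\<^sub>a\<^bsub>M\<^esub> counit E) \<cdot>\<^bsub>M\<^esub> comult E = \<iota>\<^bsub>M\<^esub> (cob E)"

definition coalg_hom ::
  "('o, 'm, 'x) monoidal_cat_scheme \<Rightarrow> ('o, 'm) coalg \<Rightarrow> ('o, 'm) coalg \<Rightarrow> 'm \<Rightarrow> bool" where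
  "coalg_hom M C D f \<longleftrightarrow> f \<in> Hom M (cob C) (cob D) \<and>
    comult D \<cdot>\<^bsub>M\<^esub> f = (f \<otimes>\<^sub>a\<^bsub>M\<^esub> f) \<cdot>\<^bsub>M\<^esub> comult C \<and>
    counit D \<cdot>\<^bsub>M\<^esub> f = counit C"

text \<open>Tensor powers are bracketed to the left, with \<open>X\<^sup>1 = X\<close> rather than \<open>\<bbbI> \<otimes> X\<close>, so that no
  constraint morphisms are needed in the iterated comultiplication.\<close>

fun tpow :: "('o, 'm, 'x) monoidal_cat_scheme \<Rightarrow> 'm \<Rightarrow> nat \<Rightarrow> 'm" where
  "tpow M p 0 = \<iota>\<^bsub>M\<^esub> \<bbbI>\<^bsub>M\<^esub>"
| "tpow M p (Suc 0) = p"
| "tpow M p (Suc (Suc n)) = tpow M p (Suc n) \<otimes>\<^sub>a\<^bsub>M\<^esub> p"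

fun comult_iter :: "('o, 'm, 'x) monoidal_cat_scheme \<Rightarrow> ('o, 'm) coalg \<Rightarrow> nat \<Rightarrow> 'm" where
  "comult_iter M E 0 = \<iota>\<^bsub>M\<^esub> (cob E)"
| "comult_iter M E (Suc 0) = comult E"
| "comult_iter M E (Suc (Suc n)) =
    (comult_iter M E (Suc n) \<otimes>\<^sub>a\<^bsub>M\<^esub> \<iota>\<^bsub>M\<^esub> (cob E)) \<cdot>\<^bsub>M\<^esub> comult E"

text \<open>\<open>(W, d)\<close> is an \<open>n\<close>-th wedge power of \<open>D\<close> in \<open>E\<close>, where \<open>p\<close> is a cokernel of the
  inclusion of \<open>D\<close>. As a kernel it is determined up to a unique isomorphism over \<open>E\<close>.\<close>

definition is_wedge_power ::
  "('o, 'm, 'x) monoidal_cat_scheme \<Rightarrow> ('o, 'm) coalg \<Rightarrow> 'm \<Rightarrow> nat \<Rightarrow> 'o \<Rightarrow> 'm \<Rightarrow> bool" where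
  "is_wedge_power M E p n W d \<longleftrightarrow> d \<in> Hom M W (cob E) \<and>
    (if n = 0 then is_zero_object M W
     else is_kernel M (tpow M p n \<cdot>\<^bsub>M\<^esub> comult_iter M E (n - 1)) d)"

text \<open>\<open>D\<close> and \<open>\<delta>\<close> enter only through \<open>p\<close>. The transition maps are determined by
  \<open>d j \<cdot> \<xi> i j = d i\<close>, since each \<open>d j\<close> is monic.\<close>

definition is_wedge_system ::
  "('o, 'm, 'x) monoidal_cat_scheme \<Rightarrow> ('o, 'm) coalg \<Rightarrow> 'm \<Rightarrow>
    (nat \<Rightarrow> 'o) \<Rightarrow> (nat \<Rightarrow> 'm) \<Rightarrow> (nat \<Rightarrow> nat \<Rightarrow> 'm) \<Rightarrow> bool" where
  "is_wedge_system M E p W d \<xi> \<longleftrightarrow>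
    (\<forall>n. is_wedge_power M E p n (W n) (d n)) \<and>
    (\<forall>i j. i \<le> j \<longrightarrow> \<xi> i j \<in> Hom M (W i) (W j) \<and> d j \<cdot>\<^bsub>M\<^esub> \<xi> i j = d i)"

definition is_direct_limit ::
  "('o, 'm, 'x) cat_scheme \<Rightarrow> (nat \<Rightarrow> 'o) \<Rightarrow> (nat \<Rightarrow> nat \<Rightarrow> 'm) \<Rightarrow> 'o \<Rightarrow> (nat \<Rightarrow> 'm) \<Rightarrow> bool" where
  "is_direct_limit M W \<xi> L c \<longleftrightarrow> is_colimit nat_order_cat M W (\<lambda>(i, j). \<xi> i j) L c"

text \<open>These structures are unique: each \<open>d n \<otimes> d n\<close> is monic by left exactness of the tensor
  functors, and the \<open>c n\<close> are jointly epic. The latter also makes \<open>LC\<close> the direct limit of the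
  \<open>WC n\<close> in the category of coalgebras.\<close>

definition is_natural_coalgebra_limit ::
  "('o, 'm, 'x) monoidal_cat_scheme \<Rightarrow> ('o, 'm) coalg \<Rightarrow> (nat \<Rightarrow> 'o) \<Rightarrow> (nat \<Rightarrow> 'm) \<Rightarrow>
    'o \<Rightarrow> (nat \<Rightarrow> 'm) \<Rightarrow> (nat \<Rightarrow> ('o, 'm) coalg) \<Rightarrow> ('o, 'm) coalg \<Rightarrow> bool" where
  "is_natural_coalgebra_limit M E W d L c WC LC \<longleftrightarrow>
    (\<forall>n. is_coalgebra M (WC n) \<and> cob (WC n) = W n \<and> coalg_hom M (WC n) E (d n)) \<and>
    is_coalgebra M LC \<and> cob LC = L \<and> (\<forall>n. coalg_hom M (WC n) LC (c n))"

end

theory Submission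
  imports Defs "HOL-Library.Nat_Bijection"
begin

text \<open>
  By AB5 it suffices that \<open>f\<close> is monic on every wedge power \<open>D\<^sup>n\<close>, by induction on \<open>n \<ge> 2\<close>.
  Let \<open>x\<close> be a generalized element of \<open>D\<^sup>n\<^sup>+\<^sup>1\<close> with \<open>f x = 0\<close>. The kernel defining \<open>D\<^sup>n\<^sup>+\<^sup>1\<close>,
  read from both ends by coassociativity, places \<open>(p \<otimes> p) \<Delta> x\<close> in both \<open>E/D \<otimes> D\<^sup>n/D\<close> and
  \<open>D\<^sup>n/D \<otimes> E/D\<close>. The map \<open>f' : E/D \<rightarrow> C/f(D)\<close> is monic on \<open>D\<^sup>n/D\<close> and \<open>f' \<otimes> f'\<close> kills
  \<open>(p \<otimes> p) \<Delta> x\<close>, so that \<open>(p \<otimes> p) \<Delta> x = 0\<close>. Hence \<open>x\<close> lies in \<open>D\<^sup>2\<close>, where \<open>f\<close> is monic.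
\<close>

section \<open>Kernels and cokernels\<close>

lemma HomD:
  assumes "f \<in> Hom M A B"
  shows "f \<in> Ar M" "Dom M f = A" "Cod M f = B"
  using assms by (auto simp: Hom_def)

lemma (in category) Hom_Ob:
  assumes "f \<in> Hom M A B"
  shows "A \<in> Ob M" "B \<in> Ob M"
  using assms Dom_in_Ob Cod_in_Ob by (auto simp: Hom_def)

lemma monicD:
  "\<lbrakk>monic M f; f \<in> Hom M A B; g \<in> Hom M X A; h \<in> Hom M X A; Cmp M f g = Cmp M f h\<rbrakk> \<Longrightarrow> g = h"
  unfolding monic_def Hom_def by blast

lemma monicI:
  assumes "f \<in> Hom M A B"
    and "\<And>X g h. \<lbrakk>g \<in> Hom M X A; h \<in> Hom M X A; Cmp M f g = Cmp M f h\<rbrakk> \<Longrightarrow> g = h"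
  shows "monic M f"
  using assms HomD[OF assms(1)] unfolding monic_def by blast

lemma (in category) monic_factor:
  assumes "k \<in> Hom M A B" "g \<in> Hom M B C" "monic M (g \<cdot> k)"
  shows "monic M k"
proof (rule monicI[OF assms(1)])
  fix X u v assume uv: "u \<in> Hom M X A" "v \<in> Hom M X A" "k \<cdot> u = k \<cdot> v"
  have "(g \<cdot> k) \<cdot> u = (g \<cdot> k) \<cdot> v"
    using Cmp_assoc[OF uv(1) assms(1,2)] Cmp_assoc[OF uv(2) assms(1,2)] uv(3) by simp
  then show "u = v" using monicD[OF assms(3) Cmp_in_Hom[OF assms(1,2)] uv(1,2)] by simp
qed

lemma (in category) monic_comp:
  assumes "k \<in> Hom M A B" "g \<in> Hom M B C" "monic M k" "monic M g"
  shows "monic M (g \<cdot> k)"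
proof (rule monicI[OF Cmp_in_Hom[OF assms(1,2)]])
  fix X u v assume uv: "u \<in> Hom M X A" "v \<in> Hom M X A" "(g \<cdot> k) \<cdot> u = (g \<cdot> k) \<cdot> v"
  have "g \<cdot> (k \<cdot> u) = g \<cdot> (k \<cdot> v)"
    using Cmp_assoc[OF uv(1) assms(1,2)] Cmp_assoc[OF uv(2) assms(1,2)] uv(3) by simp
  then have "k \<cdot> u = k \<cdot> v"
    using monicD[OF assms(4,2)] Cmp_in_Hom[OF uv(1) assms(1)] Cmp_in_Hom[OF uv(2) assms(1)] by blast
  then show "u = v" using monicD[OF assms(3,1) uv(1,2)] by simp
qed

text \<open>Serves the wedge power of index 0, which is given as a zero object and not as a
  kernel.\<close>

lemma (in category) is_zero_object_monic:
  assumes "is_zero_object M Z" "k \<in> Hom M Z B"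
  shows "monic M k"
proof (rule monicI[OF assms(2)])
  fix X g h assume "g \<in> Hom M X Z" "h \<in> Hom M X Z"
  moreover from this have "\<exists>!u. u \<in> Hom M X Z"
    using assms(1) Hom_Ob unfolding is_zero_object_def by blast
  ultimately show "g = h" by blast
qed

section \<open>Zero morphisms and the universal properties of kernels and cokernels\<close>

context preadditive_category
begin

lemma Zer_in_Hom:
  assumes "A \<in> Ob M" "B \<in> Ob M"
  shows "Zer M A B \<in> Hom M A B"
proof -
  interpret comm_group "Hom_group M A B" using Hom_comm_group assms .
  show ?thesis using one_closed by (simp add: Hom_group_def)
qed

lemma Zer_add:
  assumes "A \<in> Ob M" "B \<in> Ob M"
  shows "Zer M A B \<boxplus> Zer M A B = Zer M A B"
proof -
  interpret comm_group "Hom_group M A B" using Hom_comm_group assms .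
  show ?thesis using l_one[OF one_closed] by (simp add: Hom_group_def)
qed

text \<open>In a group only the neutral element is its own double. The zero morphism is known only
  as the neutral element of a Hom group, so this is how additivity of a map yields preservation of
  zero.\<close>

lemma idempotent_Zer:
  assumes "a \<in> Hom M A B" "a \<boxplus> a = a"
  shows "a = Zer M A B"
proof -
  interpret G: comm_group "Hom_group M A B" using Hom_comm_group Hom_Ob assms(1) by blast
  show ?thesis using G.l_cancel_one[of a a] assms by (simp add: Hom_group_def)
qed

lemma Cmp_Zer:
  assumes "h \<in> Hom M B C" "A \<in> Ob M"
  shows "h \<cdot> Zer M A B = Zer M A C"
proof (rule idempotent_Zer)
  have Z: "Zer M A B \<in> Hom M A B" using Zer_in_Hom Hom_Ob assms by blast
  show "h \<cdot> Zer M A B \<in> Hom M A C" using Cmp_in_Hom[OF Z assms(1)] .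
  show "h \<cdot> Zer M A B \<boxplus> h \<cdot> Zer M A B = h \<cdot> Zer M A B"
    using Cmp_Add_right[OF Z Z assms(1)] Zer_add[OF assms(2) Hom_Ob(1)[OF assms(1)]] by simp
qed

lemma Zer_Cmp:
  assumes "h \<in> Hom M A B" "C \<in> Ob M"
  shows "Zer M B C \<cdot> h = Zer M A C"
proof (rule idempotent_Zer)
  have Z: "Zer M B C \<in> Hom M B C" using Zer_in_Hom Hom_Ob assms by blast
  show "Zer M B C \<cdot> h \<in> Hom M A C" using Cmp_in_Hom[OF assms(1) Z] .
  show "Zer M B C \<cdot> h \<boxplus> Zer M B C \<cdot> h = Zer M B C \<cdot> h"
    using Cmp_Add_left[OF Z Z assms(1)] Zer_add[OF Hom_Ob(2)[OF assms(1)] assms(2)] by simp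
qed

text \<open>By biadditivity, equal composites amount to a difference killed by \<open>f\<close>.
  Monicity can thus be tested on generalized elements that \<open>f\<close> sends to zero.\<close>

lemma monic_if_cancel_Zer:
  assumes f: "f \<in> Hom M A B"
    and z: "\<And>X x. \<lbrakk>x \<in> Hom M X A; f \<cdot> x = Zer M X B\<rbrakk> \<Longrightarrow> x = Zer M X A"
  shows "monic M f"
proof (rule monicI[OF f])
  fix X g h assume gh: "g \<in> Hom M X A" "h \<in> Hom M X A" "f \<cdot> g = f \<cdot> h"
  interpret G: comm_group "Hom_group M X A" using Hom_comm_group Hom_Ob gh by blast
  let ?h' = "inv\<^bsub>Hom_group M X A\<^esub> h"
  have h': "?h' \<in> Hom M X A" using G.inv_closed[of h] gh by (simp add: Hom_group_def)
  have hz: "h \<boxplus> ?h' = Zer M X A" using G.r_inv[of h] gh by (simp add: Hom_group_def)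
  have "f \<cdot> (g \<boxplus> ?h') = f \<cdot> (h \<boxplus> ?h')"
    using Cmp_Add_right[OF gh(1) h' f] Cmp_Add_right[OF gh(2) h' f] gh(3) by simp
  also have "\<dots> = Zer M X B" unfolding hz using Cmp_Zer[OF f Hom_Ob(1)[OF gh(1)]] .
  finally have "g \<boxplus> ?h' = Zer M X A"
    using z[of "g \<boxplus> ?h'" X] G.m_closed[of g ?h'] gh(1) h' by (simp add: Hom_group_def)
  then have "g \<boxplus> ?h' = h \<boxplus> ?h'" using hz by metis
  then show "g = h" using G.right_cancel[of ?h' g h] gh(1,2) h' by (simp add: Hom_group_def)
qed

lemma monic_cancel_Zer:
  assumes "monic M f" "f \<in> Hom M A B" "x \<in> Hom M X A" "f \<cdot> x = Zer M X B"
  shows "x = Zer M X A"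
  using monicD[OF assms(1-3) Zer_in_Hom] Cmp_Zer[OF assms(2)] Hom_Ob(1)[OF assms(3)]
    Hom_Ob(1)[OF assms(2)] assms(4) by simp

lemma kernel_in_Hom: "\<lbrakk>is_kernel M f k; f \<in> Hom M A B\<rbrakk> \<Longrightarrow> k \<in> Hom M (Dom M k) A"
  by (auto simp: is_kernel_def Hom_def)

lemma kernel_Cmp: "\<lbrakk>is_kernel M f k; f \<in> Hom M A B\<rbrakk> \<Longrightarrow> f \<cdot> k = Zer M (Dom M k) B"
  by (auto simp: is_kernel_def Hom_def)

lemma kernel_factor:
  assumes "is_kernel M f k" "f \<in> Hom M A B" "h \<in> Hom M X A" "f \<cdot> h = Zer M X B"
  obtains u where "u \<in> Hom M X (Dom M k)" "k \<cdot> u = h"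
  using assms HomD[OF assms(2)] unfolding is_kernel_def by blast

lemma kernel_monic:
  assumes "is_kernel M f k"
  shows "monic M k"
proof -
  have f: "f \<in> Hom M (Dom M f) (Cod M f)" using assms by (simp add: is_kernel_def Hom_def)
  have k: "k \<in> Hom M (Dom M k) (Dom M f)" using kernel_in_Hom[OF assms f] .
  show ?thesis
  proof (rule monicI[OF k])
    fix X u v assume uv: "u \<in> Hom M X (Dom M k)" "v \<in> Hom M X (Dom M k)" "k \<cdot> u = k \<cdot> v"
    have "f \<cdot> (k \<cdot> u) = Zer M X (Cod M f)"
      using Cmp_assoc[OF uv(1) k f] kernel_Cmp[OF assms f] Zer_Cmp[OF uv(1)] Hom_Ob(2)[OF f] by simp
    moreover have "k \<cdot> u \<in> Hom M X (Dom M f)" using Cmp_in_Hom[OF uv(1) k] .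
    ultimately have "\<exists>!w. w \<in> Hom M X (Dom M k) \<and> k \<cdot> w = k \<cdot> u"
      using assms unfolding is_kernel_def by blast
    then show "u = v" using uv by metis
  qed
qed

lemma is_kernelI:
  assumes "f \<in> Hom M A B" "k \<in> Hom M K A" "monic M k" "f \<cdot> k = Zer M K B"
    and "\<And>X h. \<lbrakk>h \<in> Hom M X A; f \<cdot> h = Zer M X B\<rbrakk> \<Longrightarrow> \<exists>u \<in> Hom M X K. k \<cdot> u = h"
  shows "is_kernel M f k"
proof -
  have "\<exists>!u. u \<in> Hom M X K \<and> k \<cdot> u = h" if h: "h \<in> Hom M X A" "f \<cdot> h = Zer M X B" for X h
  proof -
    obtain u where u: "u \<in> Hom M X K" "k \<cdot> u = h" using assms(5)[OF h] by blast
    then show ?thesis using monicD[OF assms(3,2)] by (intro ex1I[of _ u]) auto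
  qed
  then show ?thesis unfolding is_kernel_def using HomD[OF assms(1)] HomD[OF assms(2)] assms(4) by simp
qed

lemma cokernel_in_Hom: "\<lbrakk>is_cokernel M f c; f \<in> Hom M A B\<rbrakk> \<Longrightarrow> c \<in> Hom M B (Cod M c)"
  by (auto simp: is_cokernel_def Hom_def)

lemma cokernel_Cmp: "\<lbrakk>is_cokernel M f c; f \<in> Hom M A B\<rbrakk> \<Longrightarrow> c \<cdot> f = Zer M A (Cod M c)"
  by (auto simp: is_cokernel_def Hom_def)

lemma cokernel_factor:
  assumes "is_cokernel M f c" "f \<in> Hom M A B" "h \<in> Hom M B X" "h \<cdot> f = Zer M A X"
  obtains u where "u \<in> Hom M (Cod M c) X" "u \<cdot> c = h"
  using assms HomD[OF assms(2)] unfolding is_cokernel_def by blast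

text \<open>The uniqueness clause of \<open>is_cokernel\<close> speaks of morphisms that kill
  \<open>f\<close>; a composite through \<open>c\<close> does so automatically.\<close>

lemma cokernel_cancel:
  assumes "is_cokernel M f c" "f \<in> Hom M A B"
    and uv: "u \<in> Hom M (Cod M c) X" "v \<in> Hom M (Cod M c) X" "u \<cdot> c = v \<cdot> c"
  shows "u = v"
proof -
  note c = cokernel_in_Hom[OF assms(1,2)]
  have "(u \<cdot> c) \<cdot> f = Zer M A X"
    using Cmp_assoc[OF assms(2) c uv(1)] cokernel_Cmp[OF assms(1,2)] Cmp_Zer[OF uv(1)]
      Hom_Ob(1)[OF assms(2)] by simp
  moreover have "u \<cdot> c \<in> Hom M B X" using Cmp_in_Hom[OF c uv(1)] .
  ultimately have "\<exists>!w. w \<in> Hom M (Cod M c) X \<and> w \<cdot> c = u \<cdot> c"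
    using assms(1) HomD[OF assms(2)] unfolding is_cokernel_def by blast
  then show ?thesis using uv by metis
qed

lemma cokernel_epic:
  assumes "is_cokernel M f c"
  shows "epic M c"
proof -
  have f: "f \<in> Hom M (Dom M f) (Cod M f)" using assms by (simp add: is_cokernel_def Hom_def)
  have "c \<in> Ar M" using assms by (simp add: is_cokernel_def)
  then show ?thesis unfolding epic_def using cokernel_cancel[OF assms f] by simp
qed

text \<open>The kernels \<open>k\<close> and \<open>k'\<close> factor through each other, so they
  represent the same subobject. This handles \<open>exact_at\<close>, which only provides an
  unspecified kernel of a cokernel.\<close>

lemma kernel_unique:
  assumes k: "is_kernel M c k" and k': "is_kernel M c k'" and g: "is_kernel M g k"
  shows "is_kernel M g k'"
proof -
  have cH: "c \<in> Hom M (Dom M c) (Cod M c)" and gH: "g \<in> Hom M (Dom M g) (Cod M g)"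
    using k g by (auto simp: is_kernel_def Hom_def)
  have dom: "Dom M g = Dom M c" using k g by (simp add: is_kernel_def)
  have kH: "k \<in> Hom M (Dom M k) (Dom M c)" using kernel_in_Hom[OF k cH] .
  have k'H: "k' \<in> Hom M (Dom M k') (Dom M c)" using kernel_in_Hom[OF k' cH] .
  obtain u where u: "u \<in> Hom M (Dom M k') (Dom M k)" "k \<cdot> u = k'"
    using kernel_factor[OF k cH k'H kernel_Cmp[OF k' cH]] .
  obtain v where v: "v \<in> Hom M (Dom M k) (Dom M k')" "k' \<cdot> v = k"
    using kernel_factor[OF k' cH kH kernel_Cmp[OF k cH]] .
  note gH' = gH[unfolded dom]
  show ?thesis
  proof (rule is_kernelI[OF gH' k'H kernel_monic[OF k']])
    show "g \<cdot> k' = Zer M (Dom M k') (Cod M g)"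
      using Cmp_assoc[OF u(1) kH gH'] u(2) kernel_Cmp[OF g gH] Zer_Cmp[OF u(1)] Hom_Ob(2)[OF gH]
      by simp
  next
    fix X h assume h: "h \<in> Hom M X (Dom M c)" "g \<cdot> h = Zer M X (Cod M g)"
    obtain w where w: "w \<in> Hom M X (Dom M k)" "k \<cdot> w = h"
      using kernel_factor[OF g gH'] h by blast
    have "k' \<cdot> (v \<cdot> w) = h" using Cmp_assoc[OF w(1) v(1) k'H] v(2) w(2) by simp
    then show "\<exists>u\<in>Hom M X (Dom M k'). k' \<cdot> u = h" using Cmp_in_Hom[OF w(1) v(1)] by blast
  qed
qed

lemma additive_functor_Zer:
  assumes "additive_functor M M Fo Fa" "A \<in> Ob M" "B \<in> Ob M"
  shows "Fa (Zer M A B) = Zer M (Fo A) (Fo B)"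
proof (rule idempotent_Zer)
  note Z = Zer_in_Hom[OF assms(2,3)]
  show "Fa (Zer M A B) \<in> Hom M (Fo A) (Fo B)"
    using assms(1) Z unfolding additive_functor_def is_functor_def by blast
  show "Fa (Zer M A B) \<boxplus> Fa (Zer M A B) = Fa (Zer M A B)"
    using assms(1) Z Zer_add[OF assms(2,3)] unfolding additive_functor_def by metis
qed

end

section \<open>Normal monomorphisms and left exact functors\<close>

context abelian_category
begin

text \<open>Normality makes \<open>k\<close> a kernel of some \<open>g\<close>. This
  \<open>g\<close> kills \<open>k\<close> and so factors through \<open>c\<close>; whatever
  \<open>c\<close> kills is then killed by \<open>g\<close> and lifts along
  \<open>k\<close>.\<close>

lemma monic_kernel_of_cokernel:
  assumes "monic M k" "is_cokernel M k c"
  shows "is_kernel M c k"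
proof -
  obtain g where g: "is_kernel M g k" using monic_normal[OF assms(1)] ..
  have gH: "g \<in> Hom M (Cod M k) (Cod M g)" using g by (auto simp: is_kernel_def Hom_def)
  have kH: "k \<in> Hom M (Dom M k) (Cod M k)" using kernel_in_Hom[OF g gH] .
  have cH: "c \<in> Hom M (Cod M k) (Cod M c)" using cokernel_in_Hom[OF assms(2) kH] .
  obtain g' where g': "g' \<in> Hom M (Cod M c) (Cod M g)" "g' \<cdot> c = g"
    using cokernel_factor[OF assms(2) kH gH kernel_Cmp[OF g gH]] .
  show ?thesis
  proof (rule is_kernelI[OF cH kH assms(1) cokernel_Cmp[OF assms(2) kH]])
    fix X h assume h: "h \<in> Hom M X (Cod M k)" "c \<cdot> h = Zer M X (Cod M c)"
    have "g \<cdot> h = Zer M X (Cod M g)"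
      using Cmp_assoc[OF h(1) cH g'(1)] g'(2) h(2) Cmp_Zer[OF g'(1)] Hom_Ob(1)[OF h(1)] by simp
    from kernel_factor[OF g gH h(1) this] show "\<exists>u\<in>Hom M X (Dom M k). k \<cdot> u = h" by blast
  qed
qed

text \<open>Translates exactness in the sense of \<open>exact_at\<close> into preservation of
  kernels. Since \<open>k\<close> is the kernel of its own cokernel, the functor applies to it, and
  \<open>kernel_unique\<close> replaces the kernel found on the other side by
  \<open>Fa k\<close>.\<close>

lemma left_exact_functor_kernel:
  assumes "left_exact_functor M M Fo Fa" "is_kernel M h k"
  shows "is_kernel M (Fa h) (Fa k)"
proof -
  note km = kernel_monic[OF assms(2)]
  obtain c where c: "is_cokernel M k c" using ex_cokernel assms(2) unfolding is_kernel_def by blast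
  have "exact_at M k h"
    unfolding exact_at_def using c monic_kernel_of_cokernel[OF km c] assms(2) by blast
  then have m: "monic M (Fa k)" and "exact_at M (Fa k) (Fa h)"
    using assms(1) km unfolding left_exact_functor_def by blast+
  then obtain c' k' where "is_cokernel M (Fa k) c'" "is_kernel M c' k'" "is_kernel M (Fa h) k'"
    unfolding exact_at_def by blast
  then show ?thesis using kernel_unique monic_kernel_of_cokernel[OF m] by blast
qed

end

section \<open>Directed unions of subobjects\<close>

text \<open>\<open>cocomplete\<close> and \<open>AB5\<close> admit only index categories whose
  objects and arrows lie in the one type \<open>'i\<close>. The order on the naturals is therefore
  copied into \<open>'i\<close>, with \<open>e\<close> labelling objects and \<open>b\<close>
  labelling arrows.\<close>

locale omega_copy =
  fixes e :: "nat \<Rightarrow> 'i" and b :: "nat \<times> nat \<Rightarrow> 'i"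
  assumes inj_e: "inj e" and inj_b: "inj b"
begin

definition ocat :: "('i, 'i) cat" where
  "ocat = \<lparr>Ob = range e, Ar = b ` {(i, j). i \<le> j},
    Dom = (\<lambda>u. e (fst (inv_into UNIV b u))), Cod = (\<lambda>u. e (snd (inv_into UNIV b u))),
    Idn = (\<lambda>x. b (inv_into UNIV e x, inv_into UNIV e x)), Cmp = (\<lambda>v u. b (fst (inv_into UNIV b u), snd (inv_into UNIV b v)))\<rparr>"

definition obj_map :: "(nat \<Rightarrow> 'a) \<Rightarrow> 'i \<Rightarrow> 'a" where
  "obj_map W x = W (inv_into UNIV e x)"

definition arr_map :: "(nat \<Rightarrow> nat \<Rightarrow> 'a) \<Rightarrow> 'i \<Rightarrow> 'a" where
  "arr_map \<xi> u = \<xi> (fst (inv_into UNIV b u)) (snd (inv_into UNIV b u))"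

lemma inv_eb [simp]: "inv_into UNIV e (e i) = i" "inv_into UNIV b (b u) = u"
  using inj_e inj_b by (auto simp: inv_f_f)

lemma obj_map [simp]: "obj_map W (e i) = W i"
  by (simp add: obj_map_def)

lemma arr_map [simp]: "arr_map \<xi> (b (i, j)) = \<xi> i j"
  by (simp add: arr_map_def)

lemma ocat_simps [simp]:
  "Ob ocat = range e" "Idn ocat (e i) = b (i, i)"
  "Cmp ocat (b (k, l)) (b (i, j)) = b (i, l)"
  by (simp_all add: ocat_def)

lemma Hom_ocat: "u \<in> Hom ocat x y \<longleftrightarrow> (\<exists>i j. i \<le> j \<and> x = e i \<and> y = e j \<and> u = b (i, j))"
  unfolding Hom_def ocat_def by (auto; blast)

lemma Hom_ocatI: "i \<le> j \<Longrightarrow> b (i, j) \<in> Hom ocat (e i) (e j)"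
  by (auto simp: Hom_ocat)

lemma Ar_ocat: "u \<in> Ar ocat \<Longrightarrow> \<exists>i j. i \<le> j \<and> u = b (i, j) \<and> Dom ocat u = e i \<and> Cod ocat u = e j"
  unfolding ocat_def by (auto; blast)

lemma category_ocat: "category ocat"
proof
  show "\<And>f. f \<in> Ar ocat \<Longrightarrow> Dom ocat f \<in> Ob ocat" "\<And>f. f \<in> Ar ocat \<Longrightarrow> Cod ocat f \<in> Ob ocat"
    by (auto dest!: Ar_ocat)
qed (fastforce simp: Hom_ocat inj_eq[OF inj_e])+

lemma filtered_ocat: "filtered ocat"
proof -
  have "\<exists>k u v. u \<in> Hom ocat (e i) k \<and> v \<in> Hom ocat (e j) k" for i j
    by (rule exI[of _ "e (max i j)"]) (auto simp: Hom_ocat inj_eq[OF inj_e])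
  moreover have "\<exists>k w. w \<in> Hom ocat j k \<and> Cmp ocat w u = Cmp ocat w v"
    if "u \<in> Hom ocat i j" "v \<in> Hom ocat i j" for i j u v
    using that inj_eq[OF inj_e] by (fastforce simp: Hom_ocat)
  ultimately show ?thesis unfolding filtered_def using category_ocat by auto
qed

lemma is_functor_ocat:
  assumes "\<And>i. W i \<in> Ob M" "\<And>i j. i \<le> j \<Longrightarrow> \<xi> i j \<in> Hom M (W i) (W j)"
    and "\<And>i. \<xi> i i = Idn M (W i)"
    and "\<And>i j k. \<lbrakk>i \<le> j; j \<le> k\<rbrakk> \<Longrightarrow> \<xi> i k = Cmp M (\<xi> j k) (\<xi> i j)"
  shows "is_functor ocat M (obj_map W) (arr_map \<xi>)"
  unfolding is_functor_def using assms(1-3) assms(4)[symmetric]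
  by (auto simp: Hom_ocat inj_eq[OF inj_e])

lemma is_nat_trans_ocat:
  assumes "\<And>i. \<alpha> i \<in> Hom M (V i) (W i)"
    and "\<And>i j. i \<le> j \<Longrightarrow> Cmp M (\<xi> i j) (\<alpha> i) = Cmp M (\<alpha> j) (\<eta> i j)"
  shows "is_nat_trans ocat M (obj_map V) (arr_map \<eta>) (obj_map W) (arr_map \<xi>) (obj_map \<alpha>)"
  unfolding is_nat_trans_def using assms by (auto simp: Hom_ocat)

text \<open>Legs are constrained only at labels \<open>e i\<close>. The resulting condition is the
  one for \<open>nat_order_cat\<close> applied to the legs \<open>k (e i)\<close>, which lets
  colimits be transferred.\<close>

lemma is_cocone_ocat:
  "is_cocone ocat M (obj_map W) (arr_map \<xi>) L k \<longleftrightarrow> L \<in> Ob M \<and>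
    (\<forall>i. k (e i) \<in> Hom M (W i) L) \<and> (\<forall>i j. i \<le> j \<longrightarrow> Cmp M (k (e j)) (\<xi> i j) = k (e i))"
proof -
  have "(\<forall>x y. \<forall>u \<in> Hom ocat x y. Cmp M (k y) (arr_map \<xi> u) = k x)
    \<longleftrightarrow> (\<forall>i j. i \<le> j \<longrightarrow> Cmp M (k (e j)) (\<xi> i j) = k (e i))"
  proof (intro iffI allI impI ballI)
    fix i j :: nat assume "\<forall>x y. \<forall>u \<in> Hom ocat x y. Cmp M (k y) (arr_map \<xi> u) = k x" "i \<le> j"
    then show "Cmp M (k (e j)) (\<xi> i j) = k (e i)" using Hom_ocatI[of i j] arr_map by metis
  next
    fix x y u
    assume *: "\<forall>i j. i \<le> j \<longrightarrow> Cmp M (k (e j)) (\<xi> i j) = k (e i)" and "u \<in> Hom ocat x y"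
    then obtain i j where "i \<le> j" "x = e i" "y = e j" "u = b (i, j)" unfolding Hom_ocat by blast
    then show "Cmp M (k y) (arr_map \<xi> u) = k x" using * by simp
  qed
  then show ?thesis unfolding is_cocone_def by simp
qed

end

section \<open>Direct limits of sequences\<close>

lemma Hom_nat_order_cat: "u \<in> Hom nat_order_cat i j \<longleftrightarrow> i \<le> j \<and> u = (i, j)"
  by (auto simp: nat_order_cat_def Hom_def)

lemma is_cocone_nat_order_cat:
  "is_cocone nat_order_cat M W (\<lambda>(i, j). \<xi> i j) L k \<longleftrightarrow> L \<in> Ob M \<and>
    (\<forall>i. k i \<in> Hom M (W i) L) \<and> (\<forall>i j. i \<le> j \<longrightarrow> Cmp M (k j) (\<xi> i j) = k i)"
  unfolding is_cocone_def by (auto simp: Hom_nat_order_cat) (auto simp: nat_order_cat_def)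

lemma (in omega_copy) is_colimit_ocat:
  assumes "is_direct_limit M W \<xi> L c"
  shows "is_colimit ocat M (obj_map W) (arr_map \<xi>) L (obj_map c)"
proof -
  have "\<exists>!h. h \<in> Hom M L X \<and> (\<forall>i \<in> Ob ocat. Cmp M h (obj_map c i) = k i)"
    if "is_cocone ocat M (obj_map W) (arr_map \<xi>) X k" for X k
  proof -
    have "is_cocone nat_order_cat M W (\<lambda>(i, j). \<xi> i j) X (\<lambda>i. k (e i))"
      using that unfolding is_cocone_nat_order_cat is_cocone_ocat .
    then show ?thesis
      using assms unfolding is_direct_limit_def is_colimit_def by (simp add: nat_order_cat_def)
  qed
  moreover have "is_cocone ocat M (obj_map W) (arr_map \<xi>) L (obj_map c)"
    using assms unfolding is_direct_limit_def is_colimit_def is_cocone_nat_order_cat is_cocone_ocat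
    by simp
  ultimately show ?thesis unfolding is_colimit_def by blast
qed

lemma direct_limit_cocone:
  assumes "is_direct_limit M W \<xi> L c"
  shows "L \<in> Ob M" "c i \<in> Hom M (W i) L" "i \<le> j \<Longrightarrow> Cmp M (c j) (\<xi> i j) = c i"
  using assms unfolding is_direct_limit_def is_colimit_def is_cocone_nat_order_cat by auto

text \<open>The structural morphisms are jointly epic: \<open>g\<close> and \<open>h\<close> both
  mediate the cocone \<open>g \<cdot> c i\<close>, and the mediating morphism is unique.\<close>

lemma (in category) direct_limit_cancel:
  assumes L: "is_direct_limit M W \<xi> L c" and \<xi>: "\<And>i j. i \<le> j \<Longrightarrow> \<xi> i j \<in> Hom M (W i) (W j)"
    and g: "g \<in> Hom M L X" and h: "h \<in> Hom M L X" and eq: "\<And>i. g \<cdot> c i = h \<cdot> c i"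
  shows "g = h"
proof -
  note c = direct_limit_cocone[OF L]
  have "is_cocone nat_order_cat M W (\<lambda>(i, j). \<xi> i j) X (\<lambda>i. g \<cdot> c i)"
    unfolding is_cocone_nat_order_cat using Hom_Ob[OF g] Cmp_in_Hom[OF c(2) g]
      Cmp_assoc[OF \<xi> c(2) g] c(3) by simp
  then have "\<exists>!u. u \<in> Hom M L X \<and> (\<forall>i \<in> Ob nat_order_cat. u \<cdot> c i = g \<cdot> c i)"
    using L unfolding is_direct_limit_def is_colimit_def by blast
  then show ?thesis using g h eq by metis
qed

text \<open>AB5 is applied to \<open>0 \<rightarrow> W\<^sub>i \<rightarrow> B \<rightarrow> B/W\<^sub>i \<rightarrow> 0\<close>, with the middle diagram constant.\<close>

lemma (in abelian_category) direct_limit_monic: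
  assumes inf: "infinite (UNIV :: 'i set)" and coc: "cocomplete TYPE('i) M" and ab5: "AB5 TYPE('i) M"
    and L: "is_direct_limit M W \<xi> L c" and \<xi>: "\<And>i j. i \<le> j \<Longrightarrow> \<xi> i j \<in> Hom M (W i) (W j)"
    and m: "\<And>i. m i \<in> Hom M (W i) B" and mono: "\<And>i. monic M (m i)"
    and m\<xi>: "\<And>i j. i \<le> j \<Longrightarrow> m j \<cdot> \<xi> i j = m i"
    and s: "s \<in> Hom M L B" and sc: "\<And>i. s \<cdot> c i = m i"
  shows "monic M s"
proof -
  obtain e :: "nat \<Rightarrow> 'i" where e: "inj e" using infinite_countable_subset[OF inf] by blast
  \<comment> \<open>Arrows of the order are pairs of naturals, so a pairing function lets the same
    embedding label them.\<close>
  have "inj (e \<circ> prod_encode)" using e inj_prod_encode by (simp add: inj_compose)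
  with e interpret omega_copy e "e \<circ> prod_encode" by unfold_locales
  have W: "W i \<in> Ob M" for i using Hom_Ob m by blast
  have B: "B \<in> Ob M" using Hom_Ob m by blast
  note B1 = Idn_in_Hom[OF B]
  have "\<forall>i. \<exists>q. is_cokernel M (m i) q" using ex_cokernel HomD(1)[OF m] by blast
  then obtain q where q: "\<And>i. is_cokernel M (m i) (q i)" by metis
  define Q where "Q i = Cod M (q i)" for i
  have qH: "q i \<in> Hom M B (Q i)" for i unfolding Q_def using cokernel_in_Hom[OF q m] .
  have q0: "q i \<cdot> m i = Zer M (W i) (Q i)" for i unfolding Q_def using cokernel_Cmp[OF q m] .
  have qc: "u = v" if "u \<in> Hom M (Q i) X" "v \<in> Hom M (Q i) X" "u \<cdot> q i = v \<cdot> q i" for u v i X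
    using cokernel_cancel[OF q m] that unfolding Q_def by blast
  \<comment> \<open>Transition maps of the quotients: \<open>q j\<close> kills the smaller subobject
    \<open>W i\<close> as well, so it factors through \<open>q i\<close>.\<close>
  have "\<exists>r. r \<in> Hom M (Q i) (Q j) \<and> r \<cdot> q i = q j" if "i \<le> j" for i j
  proof -
    have "q j \<cdot> m i = Zer M (W i) (Q j)"
      using Cmp_assoc[OF \<xi>[OF that] m qH[of j]] Zer_Cmp[OF \<xi>[OF that] Hom_Ob(2)[OF qH[of j]]]
      unfolding m\<xi>[OF that] q0 by simp
    from cokernel_factor[OF q m qH this] show ?thesis unfolding Q_def by blast
  qed
  then obtain r where r: "\<And>i j. i \<le> j \<Longrightarrow> r i j \<in> Hom M (Q i) (Q j)" "\<And>i j. i \<le> j \<Longrightarrow> r i j \<cdot> q i = q j"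
    by metis
  have F: "is_functor ocat M (obj_map W) (arr_map \<xi>)"
  proof (rule is_functor_ocat[OF W \<xi>])
    \<comment> \<open>Only compatibility of \<open>\<xi>\<close> with the maps \<open>m\<close> is
      given; the functor laws follow by cancelling these monics, and dually those of
      \<open>r\<close> by cancelling the cokernels \<open>q\<close>.\<close>
    show "\<xi> i i = \<iota> (W i)" for i
      using monicD[OF mono m \<xi>[of i i] Idn_in_Hom[OF W]] m\<xi>[of i i] Cmp_Idn[OF m] by simp
    show "\<xi> i k = \<xi> j k \<cdot> \<xi> i j" if "i \<le> j" "j \<le> k" for i j k
      using monicD[OF mono m \<xi>[of i k] Cmp_in_Hom[OF \<xi> \<xi>], of j] that
        Cmp_assoc[OF \<xi>[of i j] \<xi>[of j k] m] m\<xi> by simp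
  qed
  have G: "is_functor ocat M (obj_map (\<lambda>_. B)) (arr_map (\<lambda>_ _. \<iota> B))"
    using B B1 Cmp_Idn[OF B1] by (intro is_functor_ocat) simp_all
  have H: "is_functor ocat M (obj_map Q) (arr_map r)"
  proof (rule is_functor_ocat[OF Hom_Ob(2)[OF qH] r(1)])
    show "r i i = \<iota> (Q i)" for i
      using qc[OF r(1)[of i i] Idn_in_Hom[OF Hom_Ob(2)[OF qH]]] r(2)[of i i] Idn_Cmp[OF qH] by simp
    show "r i k = r j k \<cdot> r i j" if "i \<le> j" "j \<le> k" for i j k
      using qc[OF r(1)[of i k] Cmp_in_Hom[OF r(1) r(1)], of j] that
        Cmp_assoc[OF qH r(1)[of i j] r(1)[of j k]] r(2) by simp
  qed
  have \<alpha>: "is_nat_trans ocat M (obj_map W) (arr_map \<xi>) (obj_map (\<lambda>_. B)) (arr_map (\<lambda>_ _. \<iota> B)) (obj_map m)"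
    using m m\<xi> Idn_Cmp[OF m] by (intro is_nat_trans_ocat) simp_all
  have \<beta>: "is_nat_trans ocat M (obj_map (\<lambda>_. B)) (arr_map (\<lambda>_ _. \<iota> B)) (obj_map Q) (arr_map r) (obj_map q)"
    using qH r(2) Cmp_Idn[OF qH] by (intro is_nat_trans_ocat) simp_all
  have se: "\<forall>i \<in> Ob ocat. short_exact M (obj_map m i) (obj_map q i)"
  proof -
    have "short_exact M (m i) (q i)" for i
      unfolding short_exact_def exact_at_def
      using mono q monic_kernel_of_cokernel[OF mono q] cokernel_epic[OF q] by blast
    then show ?thesis by auto
  qed
  have BL: "is_colimit ocat M (obj_map (\<lambda>_. B)) (arr_map (\<lambda>_ _. \<iota> B)) B (obj_map (\<lambda>_. \<iota> B))"
  proof -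
    have "\<exists>!h. h \<in> Hom M B X \<and> (\<forall>i \<in> Ob ocat. h \<cdot> obj_map (\<lambda>_. \<iota> B) i = k i)"
      if "is_cocone ocat M (obj_map (\<lambda>_. B)) (arr_map (\<lambda>_ _. \<iota> B)) X k" for X k
    proof -
      have k: "k (e i) \<in> Hom M B X" "i \<le> j \<Longrightarrow> k (e j) \<cdot> \<iota> B = k (e i)" for i j
        using that unfolding is_cocone_ocat by auto
      \<comment> \<open>Index 0 lies below every other index, so a cocone over the constant diagram
        is determined by its leg there.\<close>
      have "k (e i) = k (e 0)" for i using k(2)[of 0 i] Cmp_Idn[OF k(1)] by simp
      then have "h \<in> Hom M B X \<and> (\<forall>i. h \<cdot> \<iota> B = k (e i)) \<longleftrightarrow> h = k (e 0)" for h
        using k(1) Cmp_Idn by metis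
      then show ?thesis by simp
    qed
    then show ?thesis unfolding is_colimit_def is_cocone_ocat using B B1 Cmp_Idn[OF B1] by simp
  qed
  \<comment> \<open>\<open>AB5\<close> compares three given colimits; cocompleteness supplies the
    one of the quotients.\<close>
  obtain N n where N: "is_colimit ocat M (obj_map Q) (arr_map r) N n"
    using coc H category_ocat unfolding cocomplete_def by blast
  then have n: "n (e i) \<in> Hom M (Q i) N" "i \<le> j \<Longrightarrow> n (e j) \<cdot> r i j = n (e i)" for i j
    unfolding is_colimit_def is_cocone_ocat by auto
  \<comment> \<open>All indices induce the same morphism from \<open>B\<close> to \<open>N\<close>;
    index 0 serves as representative.\<close>
  define v where "v = n (e 0) \<cdot> q 0"
  have v: "v \<in> Hom M B N" unfolding v_def using Cmp_in_Hom[OF qH n(1)] .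
  have vn: "n (e i) \<cdot> q i = v" for i
    unfolding v_def using Cmp_assoc[OF qH r(1)[of 0 i] n(1)] n(2)[of 0 i] r(2)[of 0 i] by simp
  have "\<forall>i \<in> Ob ocat. s \<cdot> obj_map c i = obj_map (\<lambda>_. \<iota> B) i \<cdot> obj_map m i"
    using sc Idn_Cmp[OF m] by simp
  moreover have "\<forall>i \<in> Ob ocat. v \<cdot> obj_map (\<lambda>_. \<iota> B) i = n i \<cdot> obj_map q i"
    using vn Cmp_Idn[OF v] by simp
  ultimately have "short_exact M s v"
    using ab5[unfolded AB5_def, rule_format, of ocat "obj_map W" "arr_map \<xi>" "obj_map (\<lambda>_. B)"
        "arr_map (\<lambda>_ _. \<iota> B)" "obj_map Q" "arr_map r" "obj_map m" "obj_map q" L "obj_map c"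
        B "obj_map (\<lambda>_. \<iota> B)" N n s v]
      filtered_ocat F G H \<alpha> \<beta> se is_colimit_ocat[OF L] BL N s v by blast
  then show ?thesis unfolding short_exact_def by blast
qed

section \<open>Wedge powers\<close>

text \<open>\<open>Fa k\<close> is a kernel of \<open>Fa h\<close>, so \<open>w\<close> factors
  through it, and \<open>Fa g\<close> kills \<open>Fa k\<close> by additivity. With tensor functors
  for \<open>Fa\<close>, this allows \<open>h\<close> to be replaced by \<open>g\<close> in one
  tensor factor.\<close>

lemma (in abelian_category) left_exact_Cmp_Zer:
  assumes F: "additive_functor M M Fo Fa" "left_exact_functor M M Fo Fa"
    and k: "is_kernel M h k" and h: "h \<in> Hom M A B" and g: "g \<in> Hom M A B'"
    and gk: "g \<cdot> k = Zer M (Dom M k) B'"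
    and w: "w \<in> Hom M Y (Fo A)" and hw: "Fa h \<cdot> w = Zer M Y (Fo B)"
  shows "Fa g \<cdot> w = Zer M Y (Fo B')"
proof -
  have fun_F: "is_functor M M Fo Fa" using F(1) unfolding additive_functor_def by blast
  have FH: "Fa u \<in> Hom M (Fo X) (Fo Z)" if "u \<in> Hom M X Z" for u X Z
    using fun_F that unfolding is_functor_def by blast
  note kH = kernel_in_Hom[OF k h]
  obtain w' where w': "w' \<in> Hom M Y (Fo (Dom M k))" "Fa k \<cdot> w' = w"
    using kernel_factor[OF left_exact_functor_kernel[OF F(2) k] FH[OF h] w hw]
      HomD(2)[OF FH[OF kH]] by metis
  have "Fa g \<cdot> w = (Fa g \<cdot> Fa k) \<cdot> w'" using Cmp_assoc[OF w'(1) FH[OF kH] FH[OF g]] w'(2) by simp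
  also have "Fa g \<cdot> Fa k = Fa (Zer M (Dom M k) B')"
    using fun_F kH g gk unfolding is_functor_def by metis
  also have "\<dots> = Zer M (Fo (Dom M k)) (Fo B')"
    using additive_functor_Zer[OF F(1)] Hom_Ob[OF kH] Hom_Ob[OF g] by blast
  also have "\<dots> \<cdot> w' = Zer M Y (Fo B')" using Zer_Cmp[OF w'(1)] Hom_Ob[OF FH[OF g]] by blast
  finally show ?thesis .
qed

section \<open>Tensor powers and iterated comultiplications\<close>

fun opow :: "('o, 'm, 'x) monoidal_cat_scheme \<Rightarrow> 'o \<Rightarrow> nat \<Rightarrow> 'o" where
  "opow M A 0 = \<bbbI>\<^bsub>M\<^esub>"
| "opow M A (Suc 0) = A"
| "opow M A (Suc (Suc n)) = opow M A (Suc n) \<otimes>\<^sub>o\<^bsub>M\<^esub> A"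

text \<open>For positive \<open>n\<close>, the morphism whose kernel is the \<open>n\<close>-th
  wedge power.\<close>

definition wedge_map :: "('o, 'm, 'x) monoidal_cat_scheme \<Rightarrow> ('o, 'm) coalg \<Rightarrow> 'm \<Rightarrow> nat \<Rightarrow> 'm" where
  "wedge_map M E p n = tpow M p n \<cdot>\<^bsub>M\<^esub> comult_iter M E (n - 1)"

context monoidal_category
begin

text \<open>The interchange law, shaped for right-nested composites: two adjacent tensor products
  acting on a generalized element \<open>x\<close> merge into one.\<close>

lemma tar_Cmp_Cmp:
  assumes "f \<in> Hom M A A'" "f' \<in> Hom M A' A''" "g \<in> Hom M B B'" "g' \<in> Hom M B' B''"
    and "x \<in> Hom M X (A \<otimes>\<^sub>o B)"
  shows "(f' \<otimes>\<^sub>a g') \<cdot> (f \<otimes>\<^sub>a g) \<cdot> x = ((f' \<cdot> f) \<otimes>\<^sub>a (g' \<cdot> g)) \<cdot> x"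
  using Cmp_assoc[OF assms(5) tar_in_Hom[OF assms(1,3)] tar_in_Hom[OF assms(2,4)]]
    tar_Cmp[OF assms(1-4)] by simp

lemma tpow_in_Hom: "p \<in> Hom M A B \<Longrightarrow> tpow M p n \<in> Hom M (opow M A n) (opow M B n)"
proof (induction n)
  case (Suc n)
  then show ?case by (cases n) (simp_all add: tar_in_Hom)
qed (simp add: Idn_in_Hom unt_in_Ob)

lemma comult_iter_in_Hom:
  assumes "is_coalgebra M E"
  shows "comult_iter M E n \<in> Hom M (cob E) (opow M (cob E) (Suc n))"
proof (induction n rule: nat_induct)
  case 0
  then show ?case using assms Idn_in_Hom by (simp add: is_coalgebra_def)
next
  case (Suc n)
  have E: "cob E \<in> Ob M" "comult E \<in> Hom M (cob E) (cob E \<otimes>\<^sub>o cob E)"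
    using assms by (auto simp: is_coalgebra_def)
  show ?case
    using Suc E(2) Cmp_in_Hom[OF E(2) tar_in_Hom[OF Suc Idn_in_Hom[OF E(1)]]] by (cases n) auto
qed

lemma wedge_map_in_Hom:
  assumes "is_coalgebra M E" "p \<in> Hom M (cob E) Q"
  shows "wedge_map M E p (Suc n) \<in> Hom M (cob E) (opow M Q (Suc n))"
  unfolding wedge_map_def
  using Cmp_in_Hom[OF comult_iter_in_Hom[OF assms(1)] tpow_in_Hom[OF assms(2)], of n] by simp

lemma wedge_map_1: "p \<in> Hom M (cob E) Q \<Longrightarrow> wedge_map M E p (Suc 0) = p"
  unfolding wedge_map_def using Cmp_Idn by simp

text \<open>The last factor of the iterated comultiplication is an identity, so interchange lets the
  last \<open>p\<close> act there and splits off the rightmost tensor factor.\<close>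

lemma wedge_map_Suc:
  assumes "is_coalgebra M E" "p \<in> Hom M (cob E) Q"
  shows "wedge_map M E p (Suc (Suc n)) = (wedge_map M E p (Suc n) \<otimes>\<^sub>a p) \<cdot> comult E"
proof -
  have E: "cob E \<in> Ob M" "comult E \<in> Hom M (cob E) (cob E \<otimes>\<^sub>o cob E)"
    using assms by (auto simp: is_coalgebra_def)
  \<comment> \<open>The defining recursion starts at index 2. At index 1 the same formula holds
    because a tensor product of identities is an identity.\<close>
  have "comult_iter M E (Suc n) = (comult_iter M E n \<otimes>\<^sub>a \<iota> (cob E)) \<cdot> comult E"
    using tar_Idn[OF E(1,1)] Idn_Cmp[OF E(2)] by (cases n) simp_all
  then have "wedge_map M E p (Suc (Suc n))
    = (tpow M p (Suc n) \<otimes>\<^sub>a p) \<cdot> (comult_iter M E n \<otimes>\<^sub>a \<iota> (cob E)) \<cdot> comult E"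
    unfolding wedge_map_def by simp
  also have "\<dots> = (wedge_map M E p (Suc n) \<otimes>\<^sub>a p) \<cdot> comult E"
    using tar_Cmp_Cmp[OF comult_iter_in_Hom[OF assms(1)] tpow_in_Hom[OF assms(2)]
        Idn_in_Hom[OF E(1)] assms(2) E(2)] Cmp_Idn[OF assms(2)] unfolding wedge_map_def by simp
  finally show ?thesis .
qed

text \<open>The comparison \<open>\<theta>\<close> moves the brackets of \<open>(E/D)\<^sup>n\<^sup>+\<^sup>2\<close>; only its existence matters.\<close>

lemma wedge_map_Suc_left:
  assumes E: "is_coalgebra M E" and p: "p \<in> Hom M (cob E) Q"
  shows "\<exists>\<theta> \<in> Hom M (opow M Q (Suc (Suc n))) (Q \<otimes>\<^sub>o opow M Q (Suc n)).
    \<theta> \<cdot> wedge_map M E p (Suc (Suc n)) = (p \<otimes>\<^sub>a wedge_map M E p (Suc n)) \<cdot> comult E"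
proof (induction n)
  case 0
  have Q: "Q \<in> Ob M" using Hom_Ob p by blast
  \<comment> \<open>Two factors admit only one bracketing, so the identity serves as
    \<open>\<theta>\<close>.\<close>
  have "\<iota> (Q \<otimes>\<^sub>o Q) \<cdot> wedge_map M E p (Suc (Suc 0)) = wedge_map M E p (Suc (Suc 0))"
    using Idn_Cmp[OF wedge_map_in_Hom[OF E p, of "Suc 0"]] by simp
  then show ?case
    using Idn_in_Hom[OF tob_in_Ob[OF Q Q]] wedge_map_Suc[OF E p, of 0] wedge_map_1[OF p] by auto
next
  case (Suc n)
  let ?E = "cob E" and ?\<Delta> = "comult E" and ?P = "opow M Q (Suc n)" and ?a = "assoc M Q (opow M Q (Suc n)) Q"
  let ?w = "\<lambda>n. wedge_map M E p (Suc n)"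
  have Q: "Q \<in> Ob M" using Hom_Ob p by blast
  have Eo: "?E \<in> Ob M" and \<Delta>: "?\<Delta> \<in> Hom M ?E (?E \<otimes>\<^sub>o ?E)"
    and coassoc: "assoc M ?E ?E ?E \<cdot> (?\<Delta> \<otimes>\<^sub>a \<iota> ?E) \<cdot> ?\<Delta> = (\<iota> ?E \<otimes>\<^sub>a ?\<Delta>) \<cdot> ?\<Delta>"
    using E by (auto simp: is_coalgebra_def)
  note w = wedge_map_in_Hom[OF E p, of n] and w' = wedge_map_in_Hom[OF E p, of "Suc n"]
  have P: "?P \<in> Ob M" using Hom_Ob w by blast
  note a = assoc_in_Hom[OF Q P Q] and aE = assoc_in_Hom[OF Eo Eo Eo]
  note E1 = Idn_in_Hom[OF Eo] and Q1 = Idn_in_Hom[OF Q]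
  note \<Delta>\<Delta> = Cmp_in_Hom[OF \<Delta> tar_in_Hom[OF \<Delta> E1]]
  obtain \<theta> where \<theta>: "\<theta> \<in> Hom M (opow M Q (Suc (Suc n))) (Q \<otimes>\<^sub>o ?P)"
    and \<theta>w: "\<theta> \<cdot> ?w (Suc n) = (p \<otimes>\<^sub>a ?w n) \<cdot> ?\<Delta>" using Suc by blast
  note \<theta>1 = tar_in_Hom[OF \<theta> Q1] and w1 = tar_in_Hom[OF w' p] and pwp = tar_in_Hom[OF p w]
  \<comment> \<open>The new comparison first rebrackets the left factors by the old
    \<open>\<theta>\<close> and then applies one associator.\<close>
  have "(?a \<cdot> (\<theta> \<otimes>\<^sub>a \<iota> Q)) \<cdot> ?w (Suc (Suc n)) = ?a \<cdot> (\<theta> \<otimes>\<^sub>a \<iota> Q) \<cdot> (?w (Suc n) \<otimes>\<^sub>a p) \<cdot> ?\<Delta>"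
    using Cmp_assoc[OF Cmp_in_Hom[OF \<Delta> w1] \<theta>1 a] wedge_map_Suc[OF E p, of "Suc n"] by simp
  also have "(\<theta> \<otimes>\<^sub>a \<iota> Q) \<cdot> (?w (Suc n) \<otimes>\<^sub>a p) \<cdot> ?\<Delta> = (((p \<otimes>\<^sub>a ?w n) \<cdot> ?\<Delta>) \<otimes>\<^sub>a p) \<cdot> ?\<Delta>"
    using tar_Cmp_Cmp[OF w' \<theta> p Q1 \<Delta>] \<theta>w Idn_Cmp[OF p] by simp
  also have "\<dots> = (p \<otimes>\<^sub>a ?w n \<otimes>\<^sub>a p) \<cdot> (?\<Delta> \<otimes>\<^sub>a \<iota> ?E) \<cdot> ?\<Delta>"
    using tar_Cmp_Cmp[OF \<Delta> pwp E1 p \<Delta>] Cmp_Idn[OF p] by simp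
  also have "?a \<cdot> \<dots> = (?a \<cdot> (p \<otimes>\<^sub>a ?w n \<otimes>\<^sub>a p)) \<cdot> (?\<Delta> \<otimes>\<^sub>a \<iota> ?E) \<cdot> ?\<Delta>"
    using Cmp_assoc[OF \<Delta>\<Delta> tar_in_Hom[OF pwp p] a] by simp
  \<comment> \<open>Naturality moves the associator to the copies of \<open>E\<close>, where
    coassociativity absorbs it.\<close>
  also have "\<dots> = (p \<otimes>\<^sub>a (?w n \<otimes>\<^sub>a p)) \<cdot> (\<iota> ?E \<otimes>\<^sub>a ?\<Delta>) \<cdot> ?\<Delta>"
    using assoc_natural[OF p w p] Cmp_assoc[OF \<Delta>\<Delta> aE tar_in_Hom[OF p tar_in_Hom[OF w p]]] coassoc
    by simp
  also have "\<dots> = (p \<otimes>\<^sub>a ?w (Suc n)) \<cdot> ?\<Delta>"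
    using tar_Cmp_Cmp[OF E1 p \<Delta> tar_in_Hom[OF w p] \<Delta>] Cmp_Idn[OF p] wedge_map_Suc[OF E p, of n]
    by simp
  finally show ?case using Cmp_in_Hom[OF \<theta>1 a] by auto
qed

end

text \<open>The element \<open>(p \<otimes> p) \<Delta> x\<close> comes from \<open>E/D \<otimes> W\<close> and from \<open>W \<otimes> E/D\<close>. On \<open>W\<close> the maps
  \<open>p\<close> and \<open>q f\<close> have the same kernel \<open>D\<close>, so both tensor factors can be tested after applying
  the map \<open>f'\<close> induced by \<open>f\<close> on the quotients.\<close>

lemma (in coabelian_monoidal_category) wedge_map_descent:
  assumes E: "is_coalgebra M E" and p: "p \<in> Hom M (cob E) Q" and C: "is_coalgebra M C"
    and f: "coalg_hom M E C f" and q: "q \<in> Hom M (cob C) R"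
    and f': "f' \<in> Hom M Q R" and f'p: "f' \<cdot> p = q \<cdot> f"
    and dn: "is_kernel M (wedge_map M E p (Suc n)) dn"
    and k: "is_kernel M (q \<cdot> f \<cdot> dn) k" and pk: "(p \<cdot> dn) \<cdot> k = Zer M (Dom M k) Q"
    and x: "x \<in> Hom M X (cob E)" and wx: "wedge_map M E p (Suc (Suc n)) \<cdot> x = Zer M X (opow M Q (Suc (Suc n)))"
    and fx: "f \<cdot> x = Zer M X (cob C)"
  shows "wedge_map M E p 2 \<cdot> x = Zer M X (Q \<otimes>\<^sub>o Q)"
proof -
  let ?E = "cob E" and ?\<Delta> = "comult E" and ?C = "cob C" and ?W = "Dom M dn"
  let ?w = "wedge_map M E p (Suc n)" and ?P = "opow M Q (Suc n)"
  have Eo: "?E \<in> Ob M" and \<Delta>: "?\<Delta> \<in> Hom M ?E (?E \<otimes>\<^sub>o ?E)" using E by (auto simp: is_coalgebra_def)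
  have \<Delta>C: "comult C \<in> Hom M ?C (?C \<otimes>\<^sub>o ?C)" using C by (auto simp: is_coalgebra_def)
  have fH: "f \<in> Hom M ?E ?C" and f\<Delta>: "comult C \<cdot> f = (f \<otimes>\<^sub>a f) \<cdot> ?\<Delta>"
    using f by (auto simp: coalg_hom_def)
  note w = wedge_map_in_Hom[OF E p, of n]
  note dnH = kernel_in_Hom[OF dn w]
  have obs: "Q \<in> Ob M" "R \<in> Ob M" "?W \<in> Ob M" "X \<in> Ob M"
    using Hom_Ob[OF f'] Hom_Ob[OF dnH] Hom_Ob[OF x] by auto
  note ids = Idn_in_Hom[OF Eo] Idn_in_Hom[OF obs(1)] Idn_in_Hom[OF obs(2)] Idn_in_Hom[OF obs(3)]
  note \<Delta>x = Cmp_in_Hom[OF x \<Delta>]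
  \<comment> \<open>\<open>g\<close> and \<open>h\<close> restrict \<open>p\<close> and
    \<open>q \<cdot> f\<close> to the wedge power \<open>?W\<close>; \<open>u\<close> is the element
    to be shown zero.\<close>
  define g where "g = p \<cdot> dn"
  define h where "h = q \<cdot> f \<cdot> dn"
  define u where "u = (p \<otimes>\<^sub>a p) \<cdot> ?\<Delta> \<cdot> x"
  have g: "g \<in> Hom M ?W Q" unfolding g_def using Cmp_in_Hom[OF dnH p] .
  have h: "h \<in> Hom M ?W R" unfolding h_def using Cmp_in_Hom[OF Cmp_in_Hom[OF dnH fH] q] .
  have h_eq: "h = f' \<cdot> g"
    unfolding h_def g_def using Cmp_assoc[OF dnH p f'] Cmp_assoc[OF dnH fH q] f'p by simp
  have u: "u \<in> Hom M X (Q \<otimes>\<^sub>o Q)" unfolding u_def using Cmp_in_Hom[OF \<Delta>x tar_in_Hom[OF p p]] .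
  \<comment> \<open>Applying \<open>p\<close> only to the right factor leaves an element in the
    kernel of \<open>?w\<close> tensored with \<open>Q\<close>. By left exactness it comes from
    \<open>?W\<close> tensored with \<open>Q\<close>.\<close>
  have right: "(?w \<otimes>\<^sub>a \<iota> Q) \<cdot> (\<iota> ?E \<otimes>\<^sub>a p) \<cdot> ?\<Delta> \<cdot> x = Zer M X (?P \<otimes>\<^sub>o Q)"
    using tar_Cmp_Cmp[OF ids(1) w p ids(2) \<Delta>x] Cmp_Idn[OF w] Idn_Cmp[OF p]
      Cmp_assoc[OF x \<Delta> tar_in_Hom[OF w p]] wedge_map_Suc[OF E p, of n] wx by simp
  obtain r where r: "r \<in> Hom M X (?W \<otimes>\<^sub>o Q)" "(dn \<otimes>\<^sub>a \<iota> Q) \<cdot> r = (\<iota> ?E \<otimes>\<^sub>a p) \<cdot> ?\<Delta> \<cdot> x"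
    using kernel_factor[OF left_exact_functor_kernel[OF left_exact_right[OF obs(1)] dn]
        tar_in_Hom[OF w ids(2)] Cmp_in_Hom[OF \<Delta>x tar_in_Hom[OF ids(1) p]] right]
      HomD(2)[OF tar_in_Hom[OF dnH ids(2)]] by metis
  have ur: "u = (g \<otimes>\<^sub>a \<iota> Q) \<cdot> r"
    unfolding u_def g_def
    using tar_Cmp_Cmp[OF dnH p ids(2,2) r(1)] r(2) tar_Cmp_Cmp[OF ids(1) p p ids(2) \<Delta>x]
      Cmp_Idn[OF ids(2)] Cmp_Idn[OF p] Idn_Cmp[OF p] by simp
  \<comment> \<open>The vanishing of the left-bracketed composite on \<open>x\<close> is carried by
    \<open>\<theta>\<close> to the other bracketing, which gives the mirror-image lift
    \<open>l\<close>.\<close>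
  obtain \<theta> where \<theta>: "\<theta> \<in> Hom M (opow M Q (Suc (Suc n))) (Q \<otimes>\<^sub>o ?P)"
    "\<theta> \<cdot> wedge_map M E p (Suc (Suc n)) = (p \<otimes>\<^sub>a ?w) \<cdot> ?\<Delta>" using wedge_map_Suc_left[OF E p] by blast
  have "(p \<otimes>\<^sub>a ?w) \<cdot> ?\<Delta> \<cdot> x = Zer M X (Q \<otimes>\<^sub>o ?P)"
    using Cmp_assoc[OF x \<Delta> tar_in_Hom[OF p w]] \<theta>(2) wx Cmp_Zer[OF \<theta>(1) obs(4)]
      Cmp_assoc[OF x wedge_map_in_Hom[OF E p, of "Suc n"] \<theta>(1)] by simp
  then have left: "(\<iota> Q \<otimes>\<^sub>a ?w) \<cdot> (p \<otimes>\<^sub>a \<iota> ?E) \<cdot> ?\<Delta> \<cdot> x = Zer M X (Q \<otimes>\<^sub>o ?P)"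
    using tar_Cmp_Cmp[OF p ids(2,1) w \<Delta>x] Cmp_Idn[OF w] Idn_Cmp[OF p] by simp
  obtain l where l: "l \<in> Hom M X (Q \<otimes>\<^sub>o ?W)" "(\<iota> Q \<otimes>\<^sub>a dn) \<cdot> l = (p \<otimes>\<^sub>a \<iota> ?E) \<cdot> ?\<Delta> \<cdot> x"
    using kernel_factor[OF left_exact_functor_kernel[OF left_exact_left[OF obs(1)] dn]
        tar_in_Hom[OF ids(2) w] Cmp_in_Hom[OF \<Delta>x tar_in_Hom[OF p ids(1)]] left]
      HomD(2)[OF tar_in_Hom[OF ids(2) dnH]] by metis
  have ul: "u = (\<iota> Q \<otimes>\<^sub>a g) \<cdot> l"
    unfolding u_def g_def
    using tar_Cmp_Cmp[OF ids(2,2) dnH p l(1)] l(2) tar_Cmp_Cmp[OF p ids(2) ids(1) p \<Delta>x]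
      Cmp_Idn[OF ids(2)] Cmp_Idn[OF p] Idn_Cmp[OF p] by simp
  \<comment> \<open>Since \<open>f' \<cdot> p = q \<cdot> f\<close> and \<open>f\<close> respects
    comultiplication, the value factors through \<open>comult C \<cdot> f \<cdot> x\<close>, which
    is zero.\<close>
  have "(f' \<otimes>\<^sub>a f') \<cdot> u = (q \<otimes>\<^sub>a q) \<cdot> (f \<otimes>\<^sub>a f) \<cdot> ?\<Delta> \<cdot> x"
    unfolding u_def using tar_Cmp_Cmp[OF p f' p f' \<Delta>x] tar_Cmp_Cmp[OF fH q fH q \<Delta>x] f'p by simp
  also have "(f \<otimes>\<^sub>a f) \<cdot> ?\<Delta> \<cdot> x = Zer M X (?C \<otimes>\<^sub>o ?C)"
    using Cmp_assoc[OF x \<Delta> tar_in_Hom[OF fH fH]] f\<Delta> Cmp_assoc[OF x fH \<Delta>C] fx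
      Cmp_Zer[OF \<Delta>C obs(4)] by simp
  finally have ff: "(f' \<otimes>\<^sub>a f') \<cdot> u = Zer M X (R \<otimes>\<^sub>o R)"
    using Cmp_Zer[OF tar_in_Hom[OF q q] obs(4)] by simp
  note l' = Cmp_in_Hom[OF l(1) tar_in_Hom[OF f' ids(4)]]
  \<comment> \<open>With \<open>u\<close> written through \<open>l\<close>, the right-hand
    \<open>f'\<close> becomes part of \<open>h\<close>. Replacing \<open>h\<close> by
    \<open>g\<close> removes \<open>f'\<close> from that factor.\<close>
  have "(\<iota> R \<otimes>\<^sub>a h) \<cdot> (f' \<otimes>\<^sub>a \<iota> ?W) \<cdot> l = Zer M X (R \<otimes>\<^sub>o R)"
    using tar_Cmp_Cmp[OF f' ids(3,4) h l(1)] tar_Cmp_Cmp[OF ids(2) f' g f' l(1)] ff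
      Idn_Cmp[OF f'] Cmp_Idn[OF f'] Cmp_Idn[OF h] unfolding ul h_eq by simp
  then have "(\<iota> R \<otimes>\<^sub>a g) \<cdot> (f' \<otimes>\<^sub>a \<iota> ?W) \<cdot> l = Zer M X (R \<otimes>\<^sub>o Q)"
    using left_exact_Cmp_Zer[OF additive_left[OF obs(2)] left_exact_left[OF obs(2)]
        k[folded h_def] h g pk[folded g_def] l'] by simp
  then have "(f' \<otimes>\<^sub>a \<iota> Q) \<cdot> u = Zer M X (R \<otimes>\<^sub>o Q)"
    unfolding ul
    using tar_Cmp_Cmp[OF f' ids(3,4) g l(1)] tar_Cmp_Cmp[OF ids(2) f' g ids(2) l(1)]
      Idn_Cmp[OF f'] Cmp_Idn[OF f'] Cmp_Idn[OF g] Idn_Cmp[OF g] by simp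
  \<comment> \<open>With \<open>u\<close> written through \<open>r\<close>, the remaining
    \<open>f'\<close> on the left is removed in the same way.\<close>
  then have "(h \<otimes>\<^sub>a \<iota> Q) \<cdot> r = Zer M X (R \<otimes>\<^sub>o Q)"
    unfolding ur h_eq using tar_Cmp_Cmp[OF g f' ids(2,2) r(1)] Cmp_Idn[OF ids(2)] by simp
  then have "u = Zer M X (Q \<otimes>\<^sub>o Q)"
    unfolding ur using left_exact_Cmp_Zer[OF additive_right[OF obs(1)] left_exact_right[OF obs(1)]
        k[folded h_def] h g pk[folded g_def] r(1)] by simp
  then show ?thesis
    unfolding u_def using wedge_map_Suc[OF E p, of 0] wedge_map_1[OF p]
      Cmp_assoc[OF x \<Delta> tar_in_Hom[OF p p]] by (simp add: numeral_2_eq_2)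
qed

text \<open>An element of the next wedge power killed by \<open>f\<close> lies in the second one by
  \<open>wedge_map_descent\<close>, and there \<open>fd2\<close> makes it vanish. The hypothesis
  \<open>fdn\<close> identifies the kernel of \<open>q \<cdot> f \<cdot> d (Suc n)\<close> with
  \<open>D\<close>.\<close>

lemma (in coabelian_monoidal_category) wedge_step:
  assumes E: "is_coalgebra M E" and p: "p \<in> Hom M (cob E) Q" and C: "is_coalgebra M C"
    and f: "coalg_hom M E C f"
    and p\<delta>: "is_cokernel M \<delta> p" and \<delta>: "\<delta> \<in> Hom M X0 (cob E)"
    and d: "\<And>n. is_kernel M (wedge_map M E p (Suc n)) (d (Suc n))"
    and dH: "\<And>n. d n \<in> Hom M (W n) (cob E)"
    and \<xi>: "\<And>i j. i \<le> j \<Longrightarrow> \<xi> i j \<in> Hom M (W i) (W j)"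
    and d\<xi>: "\<And>i j. i \<le> j \<Longrightarrow> d j \<cdot> \<xi> i j = d i"
    and fd2: "monic M (f \<cdot> d 2)" and fdn: "monic M (f \<cdot> d (Suc n))"
  shows "monic M (f \<cdot> d (Suc (Suc n)))"
proof -
  let ?C = "cob C"
  have fH: "f \<in> Hom M (cob E) ?C" using f by (simp add: coalg_hom_def)
  have fd: "f \<cdot> d i \<in> Hom M (W i) ?C" for i using Cmp_in_Hom[OF dH fH] .
  have dom: "Dom M (d i) = W i" for i using HomD(2)[OF dH] .
  have Q: "Q \<in> Ob M" using Hom_Ob[OF p] by simp
  have ker_p: "is_kernel M p (d 1)" using d[of 0] wedge_map_1[OF p] by simp
  have \<xi>1: "monic M (\<xi> 1 i)" if "1 \<le> i" for i
    using monic_factor[OF \<xi>[OF that] dH] kernel_monic[OF ker_p] d\<xi>[OF that] by simp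
  have fd1: "monic M (f \<cdot> d 1)"
  proof -
    have "f \<cdot> d 1 = (f \<cdot> d 2) \<cdot> \<xi> 1 2" using Cmp_assoc[OF \<xi> dH fH, of 1 2] d\<xi>[of 1 2] by simp
    then show ?thesis using monic_comp[OF \<xi>[of 1 2] fd \<xi>1 fd2] by simp
  qed
  \<comment> \<open>\<open>q\<close> projects \<open>C\<close> onto \<open>C/f(D)\<close>, with
    \<open>D\<close> represented by \<open>d 1\<close>.\<close>
  obtain q where q: "is_cokernel M (f \<cdot> d 1) q" using ex_cokernel HomD(1)[OF fd] by blast
  define R where "R = Cod M q"
  have qH: "q \<in> Hom M ?C R" unfolding R_def using cokernel_in_Hom[OF q fd] .
  have q0: "q \<cdot> f \<cdot> d 1 = Zer M (W 1) R" unfolding R_def using cokernel_Cmp[OF q fd] .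
  note ker_q = monic_kernel_of_cokernel[OF fd1 q]
  have p\<delta>0: "p \<cdot> \<delta> = Zer M X0 Q" using cokernel_Cmp[OF p\<delta> \<delta>] HomD[OF p] by simp
  \<comment> \<open>As \<open>p\<close> kills \<open>\<delta>\<close>, the latter lifts through the
    kernel \<open>d 1\<close>. Hence \<open>q \<cdot> f\<close> kills \<open>\<delta>\<close> and
    descends to \<open>f'\<close> on the cokernel.\<close>
  obtain t where t: "t \<in> Hom M X0 (W 1)" "d 1 \<cdot> t = \<delta>"
    using kernel_factor[OF ker_p p \<delta> p\<delta>0] dom by metis
  have "(q \<cdot> f) \<cdot> \<delta> = Zer M X0 R"
    using Cmp_assoc[OF \<delta> fH qH] Cmp_assoc[OF t(1) dH fH] Cmp_assoc[OF t(1) fd qH] q0 t(2)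
      Zer_Cmp[OF t(1) Hom_Ob(2)[OF qH]] by simp
  from cokernel_factor[OF p\<delta> \<delta> Cmp_in_Hom[OF fH qH] this]
  obtain f' where f': "f' \<in> Hom M Q R" "f' \<cdot> p = q \<cdot> f" using HomD(3)[OF p] by metis
  \<comment> \<open>An element whose image under \<open>f\<close> dies in \<open>C/f(D)\<close> has
    the same image as an element of \<open>D\<close>; as \<open>f\<close> is monic on this wedge
    power, it is that element.\<close>
  have k: "is_kernel M (q \<cdot> f \<cdot> d (Suc n)) (\<xi> 1 (Suc n))"
  proof (rule is_kernelI[OF Cmp_in_Hom[OF fd qH] \<xi> \<xi>1])
    show "(q \<cdot> f \<cdot> d (Suc n)) \<cdot> \<xi> 1 (Suc n) = Zer M (W 1) R"
      using Cmp_assoc[OF \<xi> fd qH, of 1 "Suc n"] Cmp_assoc[OF \<xi> dH fH, of 1 "Suc n"] d\<xi>[of 1 "Suc n"] q0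
      by simp
  next
    fix X h assume h: "h \<in> Hom M X (W (Suc n))" "(q \<cdot> f \<cdot> d (Suc n)) \<cdot> h = Zer M X R"
    have "q \<cdot> (f \<cdot> d (Suc n)) \<cdot> h = Zer M X R" using Cmp_assoc[OF h(1) fd qH] h(2) by simp
    from kernel_factor[OF ker_q qH Cmp_in_Hom[OF h(1) fd] this]
    obtain z where z: "z \<in> Hom M X (W 1)" "(f \<cdot> d 1) \<cdot> z = (f \<cdot> d (Suc n)) \<cdot> h"
      using HomD(2)[OF fd] by metis
    note \<xi>z = Cmp_in_Hom[OF z(1) \<xi>[of 1 "Suc n"]]
    have "(f \<cdot> d (Suc n)) \<cdot> \<xi> 1 (Suc n) \<cdot> z = (f \<cdot> d (Suc n)) \<cdot> h"
      using Cmp_assoc[OF z(1) \<xi> fd, of "Suc n"] Cmp_assoc[OF \<xi> dH fH, of 1 "Suc n"]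
        d\<xi>[of 1 "Suc n"] z(2) by simp
    then have "\<xi> 1 (Suc n) \<cdot> z = h" using monicD[OF fdn fd \<xi>z h(1)] by simp
    then show "\<exists>u\<in>Hom M X (W 1). \<xi> 1 (Suc n) \<cdot> u = h" using z(1) by blast
  qed simp_all
  have pk: "(p \<cdot> d (Suc n)) \<cdot> \<xi> 1 (Suc n) = Zer M (Dom M (\<xi> 1 (Suc n))) Q"
    using Cmp_assoc[OF \<xi> dH p, of 1 "Suc n"] d\<xi>[of 1 "Suc n"] kernel_Cmp[OF ker_p p]
      HomD(2)[OF \<xi>[of 1 "Suc n"]] dom by simp
  show ?thesis
  proof (rule monic_if_cancel_Zer[OF fd])
    fix X y assume y: "y \<in> Hom M X (W (Suc (Suc n)))" "(f \<cdot> d (Suc (Suc n))) \<cdot> y = Zer M X ?C"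
    \<comment> \<open>Viewed inside \<open>E\<close>, the element can be compared with the second
      wedge power.\<close>
    define x where "x = d (Suc (Suc n)) \<cdot> y"
    have X: "X \<in> Ob M" using Hom_Ob[OF y(1)] by simp
    have x: "x \<in> Hom M X (cob E)" unfolding x_def using Cmp_in_Hom[OF y(1) dH] .
    have fx: "f \<cdot> x = Zer M X ?C" unfolding x_def using Cmp_assoc[OF y(1) dH fH] y(2) by simp
    note w = wedge_map_in_Hom[OF E p, of "Suc n"] and w2 = wedge_map_in_Hom[OF E p, of "Suc 0"]
    have wx: "wedge_map M E p (Suc (Suc n)) \<cdot> x = Zer M X (opow M Q (Suc (Suc n)))"
      unfolding x_def
      using Cmp_assoc[OF y(1) dH w] kernel_Cmp[OF d w] dom Zer_Cmp[OF y(1) Hom_Ob(2)[OF w]] by simp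
    have "wedge_map M E p 2 \<cdot> x = Zer M X (Q \<otimes>\<^sub>o Q)"
      using wedge_map_descent[OF E p C f qH f' d k pk x wx fx] .
    then have "wedge_map M E p (Suc (Suc 0)) \<cdot> x = Zer M X (opow M Q (Suc (Suc 0)))"
      by (simp add: numeral_2_eq_2)
    from kernel_factor[OF d w2 x this]
    obtain z where z: "z \<in> Hom M X (W 2)" "d 2 \<cdot> z = x" using dom by (metis numeral_2_eq_2)
    have "(f \<cdot> d 2) \<cdot> z = Zer M X ?C" using Cmp_assoc[OF z(1) dH fH] z(2) fx by simp
    then have "z = Zer M X (W 2)" using monic_cancel_Zer[OF fd2 fd z(1)] by simp
    then have "d (Suc (Suc n)) \<cdot> y = Zer M X (cob E)" using z(2) Cmp_Zer[OF dH X] unfolding x_def by simp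
    then show "y = Zer M X (W (Suc (Suc n)))"
      using monic_cancel_Zer[OF kernel_monic[OF d] dH y(1)] by simp
  qed
qed

section \<open>Coalgebra homomorphisms out of a direct limit\<close>

lemma (in monoidal_category) coalg_hom_comp:
  assumes "coalg_hom M A B g" "coalg_hom M B C f"
    and A: "is_coalgebra M A" and B: "is_coalgebra M B" and C: "is_coalgebra M C"
  shows "coalg_hom M A C (f \<cdot> g)"
proof -
  have g: "g \<in> Hom M (cob A) (cob B)" "comult B \<cdot> g = (g \<otimes>\<^sub>a g) \<cdot> comult A" "counit B \<cdot> g = counit A"
    and f: "f \<in> Hom M (cob B) (cob C)" "comult C \<cdot> f = (f \<otimes>\<^sub>a f) \<cdot> comult B" "counit C \<cdot> f = counit B"
    using assms by (auto simp: coalg_hom_def)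
  have \<Delta>: "comult A \<in> Hom M (cob A) (cob A \<otimes>\<^sub>o cob A)" "comult B \<in> Hom M (cob B) (cob B \<otimes>\<^sub>o cob B)"
    "comult C \<in> Hom M (cob C) (cob C \<otimes>\<^sub>o cob C)" "counit C \<in> Hom M (cob C) \<bbbI>"
    using A B C by (auto simp: is_coalgebra_def)
  have "comult C \<cdot> f \<cdot> g = (f \<otimes>\<^sub>a f) \<cdot> (g \<otimes>\<^sub>a g) \<cdot> comult A"
    using Cmp_assoc[OF g(1) f(1) \<Delta>(3)] f(2) Cmp_assoc[OF g(1) \<Delta>(2) tar_in_Hom[OF f(1) f(1)]] g(2)
    by simp
  also have "\<dots> = ((f \<cdot> g) \<otimes>\<^sub>a (f \<cdot> g)) \<cdot> comult A"
    using tar_Cmp_Cmp[OF g(1) f(1) g(1) f(1) \<Delta>(1)] .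
  finally show ?thesis
    unfolding coalg_hom_def
    using Cmp_in_Hom[OF g(1) f(1)] Cmp_assoc[OF g(1) f(1) \<Delta>(4)] f(3) g(3) by simp
qed

text \<open>Both sides of each coalgebra identity agree after composition with every
  \<open>c i\<close>, because \<open>c i\<close> and \<open>d i\<close> are coalgebra homomorphisms.
  Joint epicness of the \<open>c i\<close> does the rest.\<close>

lemma (in monoidal_category) coalg_hom_direct_limit:
  assumes L: "is_direct_limit M W \<xi> (cob A) c" and \<xi>: "\<And>i j. i \<le> j \<Longrightarrow> \<xi> i j \<in> Hom M (W i) (W j)"
    and A: "is_coalgebra M A" and E: "is_coalgebra M E"
    and G: "\<And>i. is_coalgebra M (G i)" "\<And>i. cob (G i) = W i"
    and c: "\<And>i. coalg_hom M (G i) A (c i)" and d: "\<And>i. coalg_hom M (G i) E (d i)"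
    and s: "s \<in> Hom M (cob A) (cob E)" and sc: "\<And>i. s \<cdot> c i = d i"
  shows "coalg_hom M A E s"
proof -
  have cH: "c i \<in> Hom M (W i) (cob A)" "comult A \<cdot> c i = (c i \<otimes>\<^sub>a c i) \<cdot> comult (G i)"
      "counit A \<cdot> c i = counit (G i)"
    and dH: "comult E \<cdot> d i = (d i \<otimes>\<^sub>a d i) \<cdot> comult (G i)" "counit E \<cdot> d i = counit (G i)" for i
    using c[of i] d[of i] G(2) by (auto simp: coalg_hom_def)
  have \<Delta>: "comult A \<in> Hom M (cob A) (cob A \<otimes>\<^sub>o cob A)" "comult E \<in> Hom M (cob E) (cob E \<otimes>\<^sub>o cob E)"
    "counit A \<in> Hom M (cob A) \<bbbI>" "counit E \<in> Hom M (cob E) \<bbbI>"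
    using A E by (auto simp: is_coalgebra_def)
  have \<Delta>G: "comult (G i) \<in> Hom M (W i) (W i \<otimes>\<^sub>o W i)" for i
    using G(1)[of i] G(2)[of i] by (auto simp: is_coalgebra_def)
  note ss = tar_in_Hom[OF s s]
  have "comult E \<cdot> s = (s \<otimes>\<^sub>a s) \<cdot> comult A"
  proof (rule direct_limit_cancel[OF L \<xi> Cmp_in_Hom[OF s \<Delta>(2)] Cmp_in_Hom[OF \<Delta>(1) ss]])
    fix i
    have "(comult E \<cdot> s) \<cdot> c i = (d i \<otimes>\<^sub>a d i) \<cdot> comult (G i)"
      using Cmp_assoc[OF cH(1) s \<Delta>(2)] sc dH(1) by simp
    also have "\<dots> = (s \<otimes>\<^sub>a s) \<cdot> (c i \<otimes>\<^sub>a c i) \<cdot> comult (G i)"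
      using tar_Cmp_Cmp[OF cH(1) s cH(1) s \<Delta>G] sc by simp
    also have "\<dots> = ((s \<otimes>\<^sub>a s) \<cdot> comult A) \<cdot> c i"
      using Cmp_assoc[OF cH(1) \<Delta>(1) ss] cH(2) by simp
    finally show "(comult E \<cdot> s) \<cdot> c i = ((s \<otimes>\<^sub>a s) \<cdot> comult A) \<cdot> c i" .
  qed
  moreover have "counit E \<cdot> s = counit A"
    by (rule direct_limit_cancel[OF L \<xi> Cmp_in_Hom[OF s \<Delta>(4)] \<Delta>(3)])
      (use Cmp_assoc[OF cH(1) s \<Delta>(4)] sc dH(2) cH(3) in simp_all)
  ultimately show ?thesis unfolding coalg_hom_def using s by simp
qed

section \<open>Induction over the wedge powers and passage to the limit\<close>

theorem theorem2p4:
  fixes M :: "('o, 'm, 'x) monoidal_cat_scheme" (structure)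
    and D E C :: "('o, 'm) coalg"
    and \<delta> p \<delta>' f :: 'm
    and W :: "nat \<Rightarrow> 'o" and d :: "nat \<Rightarrow> 'm" and \<xi> :: "nat \<Rightarrow> nat \<Rightarrow> 'm"
    and L :: 'o and c :: "nat \<Rightarrow> 'm"
  assumes "coabelian_monoidal_category M"
    and "infinite (UNIV :: 'i set)"
    and "cocomplete TYPE('i) M"
    and "AB5 TYPE('i) M"
    and "is_coalgebra M D" and "is_coalgebra M E"
    and "monic M \<delta>" and "coalg_hom M D E \<delta>"
    and "is_cokernel M \<delta> p"
    and "is_wedge_system M E p W d \<xi>"
    and "is_direct_limit M W \<xi> L c"
    and "\<delta>' \<in> Hom M L (cob E)" and "\<And>i. \<delta>' \<cdot> c i = d i"
    and "is_coalgebra M C" and "coalg_hom M E C f"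
    and "monic M (f \<cdot> d 2)"
  shows "monic M (f \<cdot> \<delta>') \<and>
    (\<forall>WC LC. is_natural_coalgebra_limit M E W d L c WC LC \<longrightarrow> coalg_hom M LC C (f \<cdot> \<delta>'))"
proof -
  interpret coabelian_monoidal_category M by (fact assms(1))
  have \<delta>: "\<delta> \<in> Hom M (cob D) (cob E)" using assms(8) by (simp add: coalg_hom_def)
  have f: "f \<in> Hom M (cob E) (cob C)" using assms(15) by (simp add: coalg_hom_def)
  note p = cokernel_in_Hom[OF assms(9) \<delta>]
  have wp: "is_wedge_power M E p n (W n) (d n)" for n
    using assms(10) unfolding is_wedge_system_def by blast
  have \<xi>: "\<xi> i j \<in> Hom M (W i) (W j)" and d\<xi>: "d j \<cdot> \<xi> i j = d i" if "i \<le> j" for i j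
    using assms(10) that unfolding is_wedge_system_def by blast+
  have d: "d n \<in> Hom M (W n) (cob E)" for n using wp unfolding is_wedge_power_def by blast
  have ker: "is_kernel M (wedge_map M E p (Suc n)) (d (Suc n))" for n
    using wp[of "Suc n"] unfolding is_wedge_power_def wedge_map_def by simp
  have d_monic: "monic M (d n)" for n
  proof (cases n)
    case 0
    then show ?thesis using is_zero_object_monic[OF _ d] wp[of 0] unfolding is_wedge_power_def by simp
  next
    case (Suc k)
    then show ?thesis using kernel_monic[OF ker] by simp
  qed
  have fd: "f \<cdot> d n \<in> Hom M (W n) (cob C)" for n using Cmp_in_Hom[OF d f] .
  \<comment> \<open>The induction is shifted by two so that its base is the hypothesis on the second
    wedge power.\<close>
  have ge2: "monic M (f \<cdot> d (Suc (Suc n)))" for n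
  proof (induction n)
    case 0
    then show ?case using assms(16) by (simp add: numeral_2_eq_2)
  next
    case (Suc n)
    then show ?case
      using wedge_step[OF assms(6) p assms(14,15,9) \<delta> ker d \<xi> d\<xi> assms(16)] by blast
  qed
  have fd\<xi>: "(f \<cdot> d j) \<cdot> \<xi> i j = f \<cdot> d i" if "i \<le> j" for i j
    using Cmp_assoc[OF \<xi>[OF that] d f] d\<xi>[OF that] by simp
  \<comment> \<open>Indices 0 and 1 are reached by restriction: each power embeds by
    \<open>\<xi>\<close> into the one two steps further.\<close>
  have fd_monic: "monic M (f \<cdot> d n)" for n
  proof -
    have le: "n \<le> Suc (Suc n)" by simp
    have "monic M (\<xi> n (Suc (Suc n)))"
      using monic_factor[OF \<xi>[OF le] d] d\<xi>[OF le] d_monic by simp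
    then show ?thesis using monic_comp[OF \<xi>[OF le] fd _ ge2] fd\<xi>[OF le] by simp
  qed
  have "(f \<cdot> \<delta>') \<cdot> c i = f \<cdot> d i" for i
    using Cmp_assoc[OF direct_limit_cocone(2)[OF assms(11)] assms(12) f] assms(13) by simp
  \<comment> \<open>The system is regarded as one of subobjects of \<open>C\<close> through the maps
    \<open>f \<cdot> d n\<close>, with \<open>f \<cdot> \<delta>'\<close> as the induced map on the
    limit.\<close>
  then have "monic M (f \<cdot> \<delta>')"
    using direct_limit_monic[OF assms(2-4,11) \<xi> fd fd_monic fd\<xi> Cmp_in_Hom[OF assms(12) f]] by blast
  moreover have "coalg_hom M LC C (f \<cdot> \<delta>')"
    if "is_natural_coalgebra_limit M E W d L c WC LC" for WC LC
  proof -
    have n: "is_coalgebra M (WC i)" "cob (WC i) = W i" "coalg_hom M (WC i) E (d i)"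
      "coalg_hom M (WC i) LC (c i)" "is_coalgebra M LC" "cob LC = L" for i
      using that unfolding is_natural_coalgebra_limit_def by auto
    have "coalg_hom M LC E \<delta>'"
      using coalg_hom_direct_limit[OF _ \<xi> n(5) assms(6) n(1,2,4,3)] n(6) assms(11-13) by simp
    then show ?thesis using coalg_hom_comp assms(6,14,15) n(5) by blast
  qed
  ultimately show ?thesis by blast
qed

end
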